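(* Let $a,b,c_0$ be positive real numbers with $b>1$. There is a positive real number $c$, depending only on $a$, $b$ and $c_0$ and computable from them, with the following property. Suppose that $f$ is analytic in the open unit disk, that $|f(z)|\le\phi(z)^{c_0\phi(z)}$ for all $z$ in the disk with $|z|\ge 1/2$, and that $|f(x)|\ge a\,b^{\phi(x)}$ for all $x\in(0,1)$. Then for $H\ge e$ the number of rationals $q\in(0,1)$ such that $f(q)$ is also rational and both $q$ and $f(q)$ have multiplicative height at most $H$ is at most $$c(\log H)^{18}.$$
   Context: For $z$ in the open unit disk of $\mathbb{C}$, $\phi(z)=\frac{1}{1-|z|}$. The multiplicative height of a rational number $p/q$ in lowest terms is $\max\{|p|,|q|\}$. *)

theory Defs
  imports "HOL-Complex_Analysis.Complex_Analysis"
begin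

definition disk_phi :: "complex \<Rightarrow> real" where
  "disk_phi z = 1 / (1 - norm z)"

definition mult_height :: "rat \<Rightarrow> int" where
  "mult_height q = (case quotient_of q of (m, d) \<Rightarrow> max \<bar>m\<bar> \<bar>d\<bar>)"

text \<open>
  Computability of real functions in the usual sense of computable analysis: one algorithm,
  with access to arbitrary approximations of the arguments, produces approximations of the
  value to any prescribed accuracy.  The algorithms are partial recursive functions relative to
  a family of oracles \<open>A i\<close>.  \<open>run P A xs = None\<close> means that the program
  \<open>P\<close> diverges, or is given the wrong number of arguments.
\<close>

datatype program =
    Zero
  | Succ
  | Arg nat
  | Query nat
  | Compose program "program list"
  | PrimRec program program
  | Minimize program

primrec run :: "program \<Rightarrow> (nat \<Rightarrow> nat \<Rightarrow> nat) \<Rightarrow> nat list \<Rightarrow> nat option" where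
  "run Zero A xs = Some 0"
| "run Succ A xs = (case xs of [n] \<Rightarrow> Some (Suc n) | _ \<Rightarrow> None)"
| "run (Arg i) A xs = (if i < length xs then Some (xs ! i) else None)"
| "run (Query i) A xs = (case xs of [k] \<Rightarrow> Some (A i k) | _ \<Rightarrow> None)"
| "run (Compose f gs) A xs =
     Option.bind (those (map (\<lambda>g. run g A xs) gs)) (\<lambda>ys. run f A ys)"
| "run (PrimRec f g) A xs =
     (case xs of
        [] \<Rightarrow> None
      | n # ys \<Rightarrow>
          rec_nat (run f A ys) (\<lambda>m r. Option.bind r (\<lambda>y. run g A (m # y # ys))) n)"
| "run (Minimize f) A xs =
     (if \<exists>n. run f A (n # xs) = Some 0 \<and> (\<forall>m<n. run f A (m # xs) \<noteq> None)
      then Some (LEAST n. run f A (n # xs) = Some 0) else None)"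

text \<open>
  A name of a nonnegative real \<open>x\<close>: a sequence of numerators of dyadic
  approximations.  Negative reals have no name of this kind, so the notion of computability
  below is meant for nonnegative arguments and values only.
\<close>

definition dyadic_name :: "(nat \<Rightarrow> nat) \<Rightarrow> real \<Rightarrow> bool" where
  "dyadic_name p x \<longleftrightarrow> (\<forall>k. \<bar>real (p k) / 2 ^ k - x\<bar> \<le> 1 / 2 ^ k)"

definition computable_real_on :: "real list set \<Rightarrow> (real list \<Rightarrow> real) \<Rightarrow> bool" where
  "computable_real_on D F \<longleftrightarrow>
     (\<exists>P. \<forall>xs\<in>D. \<forall>A. (\<forall>i<length xs. dyadic_name (A i) (xs ! i)) \<longrightarrow>
        (\<exists>p. (\<forall>k. run P A [k] = Some (p k)) \<and> dyadic_name p (F xs)))"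

end

(*
  Since |f(q)| is at most H and f grows exponentially in phi along the real axis, every counted q
  is at distance at least of order 1 / log H from the unit circle.  Siegel's lemma gives a nonzero
  integer polynomial P(z, w), with both degrees of order (log H)^3, such that G(z) = P(z, f(z))
  vanishes at half as many counted points as P has coefficients.  Dividing G by the corresponding
  Blaschke factors makes G(q) smaller than the reciprocal of its denominator at every other
  counted q, so G vanishes at all of them.  The top coefficient of P as a polynomial in w is a
  nonzero integer polynomial; it does not vanish at some x = 1 - 1/v with v of order (log H)^4, and
  is therefore not too small there, while f(x) is so large that the top term dominates G(x).
  Dividing G by the Blaschke factors of all the counted q and comparing with the lower bound for
  |G(x)| bounds their number by a multiple of (log H)^15.

  As a constant depending computably on a, b, c0 one can take a large power of
  (1 + c0) / min(a, b - 1, 1), which bounds 1, c0, 1/a and 1 / (2 ln b) from above.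
*)

theory Submission
  imports Defs
begin

section \<open>An integer solution of a linear system\<close>

text \<open>Pigeonhole (Siegel's lemma): the box of vectors with entries in \<open>{0..X}\<close>
  has \<open>(X + 1) ^ (2 * card J)\<close> points, but the system takes at most
  \<open>(X * X + 1) ^ card J\<close> values on it. The difference of two vectors with the same
  image is the solution.\<close>

lemma siegel_integer_solution:
  fixes A :: "'j \<Rightarrow> 'i \<Rightarrow> int" and B :: int
  assumes fin: "finite I" "finite J" and J: "J \<noteq> {}" and cardI: "card I = 2 * card J"
    and B: "\<And>j i. j \<in> J \<Longrightarrow> i \<in> I \<Longrightarrow> \<bar>A j i\<bar> \<le> B" "B \<ge> 1"
  shows "\<exists>p. (\<exists>i\<in>I. p i \<noteq> 0) \<and> (\<forall>i\<in>I. \<bar>p i\<bar> \<le> int (card I) * B) \<and>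
    (\<forall>j\<in>J. (\<Sum>i\<in>I. A j i * p i) = 0)"
proof -
  define X where "X = int (card I) * B"
  have X0: "X \<ge> 1"
    using J fin cardI B(2) unfolding X_def
    by (metis card_gt_0_iff mult_pos_pos of_nat_0_less_iff zero_less_numeral int_one_le_iff_zero_less)
  define V where "V = I \<rightarrow>\<^sub>E {0..X}"
  define \<Phi> where "\<Phi> = (\<lambda>v. restrict (\<lambda>j. \<Sum>i\<in>I. A j i * v i) J)"
  \<comment> \<open>The extreme values of row \<open>j\<close> on the box: negative coefficients
    count only in \<open>lo\<close>, positive ones only in \<open>up\<close>. The length of the
    interval is therefore \<open>X\<close> times the sum of the \<open>\<bar>A j i\<bar>\<close>, at
    most \<open>X * X\<close>.\<close>
  define lo where "lo = (\<lambda>j. \<Sum>i\<in>I. min 0 (A j i) * X)"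
  define up where "up = (\<lambda>j. \<Sum>i\<in>I. max 0 (A j i) * X)"
  have cardV: "card V = (nat X + 1) ^ card I"
    using fin X0 by (simp add: V_def card_PiE nat_add_distrib)
  have sub: "\<Phi> ` V \<subseteq> (\<Pi>\<^sub>E j\<in>J. {lo j..up j})"
  proof (intro image_subsetI PiE_I)
    fix v j assume v: "v \<in> V" and j: "j \<in> J"
    have "min 0 (A j i) * X \<le> A j i * v i \<and> A j i * v i \<le> max 0 (A j i) * X" if "i \<in> I" for i
    proof -
      have "0 \<le> v i" "v i \<le> X" using v that by (auto simp: V_def PiE_iff)
      then show ?thesis
        by (cases "A j i \<ge> 0") (auto simp: min_def max_def mult_left_mono mult_left_mono_neg mult_nonpos_nonneg)
    qed
    then show "\<Phi> v j \<in> {lo j..up j}"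
      using j by (auto simp: \<Phi>_def lo_def up_def intro!: sum_mono)
  qed (simp add: \<Phi>_def)
  have width: "card {lo j..up j} \<le> nat X * nat X + 1" if j: "j \<in> J" for j
  proof -
    have "up j - lo j = (\<Sum>i\<in>I. \<bar>A j i\<bar> * X)"
      unfolding up_def lo_def sum_subtractf[symmetric]
      by (intro sum.cong refl) (auto simp: min_def max_def algebra_simps)
    also have "\<dots> \<le> (\<Sum>i\<in>I. B * X)"
      using B j X0 by (intro sum_mono mult_right_mono) auto
    also have "\<dots> = X * X" by (simp add: X_def)
    finally have "up j - lo j + 1 \<le> X * X + 1" by simp
    then have "nat (up j - lo j + 1) \<le> nat (X * X + 1)" by (rule nat_mono)
    then show ?thesis using X0 by (simp add: nat_add_distrib nat_mult_distrib algebra_simps)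
  qed
  have "card (\<Phi> ` V) \<le> card (\<Pi>\<^sub>E j\<in>J. {lo j..up j})"
    by (intro card_mono sub finite_PiE fin) auto
  also have "\<dots> = (\<Prod>j\<in>J. card {lo j..up j})" using fin by (simp add: card_PiE)
  also have "\<dots> \<le> (\<Prod>j\<in>J. nat X * nat X + 1)" using width by (intro prod_mono) auto
  also have "\<dots> = (nat X * nat X + 1) ^ card J" by simp
  also have "\<dots> < ((nat X + 1) ^ 2) ^ card J"
    using J fin X0 by (intro power_strict_mono) (auto simp: power2_eq_square card_gt_0_iff)
  also have "\<dots> = card V" by (simp add: cardV cardI power_mult)
  finally have "\<not> inj_on \<Phi> V" by (rule pigeonhole)
  then obtain v w where vw: "v \<in> V" "w \<in> V" "\<Phi> v = \<Phi> w" "v \<noteq> w" by (auto simp: inj_on_def)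
  show ?thesis
  proof (intro exI[of _ "\<lambda>i. v i - w i"] conjI ballI)
    show "\<exists>i\<in>I. v i - w i \<noteq> 0"
      using vw(1,2,4) unfolding V_def by (metis PiE_ext eq_iff_diff_eq_0)
  next
    fix i assume "i \<in> I"
    then show "\<bar>v i - w i\<bar> \<le> int (card I) * B"
      using vw(1,2) unfolding V_def X_def[symmetric] by (force simp: PiE_iff)
  next
    fix j assume "j \<in> J"
    then show "(\<Sum>i\<in>I. A j i * (v i - w i)) = 0"
      using fun_cong[OF vw(3), of j] by (simp add: \<Phi>_def algebra_simps sum_subtractf)
  qed
qed

section \<open>Zeros of bounded holomorphic functions\<close>

text \<open>On the circle \<open>R\<^sup>2 = z * cnj z\<close>, so the left side is
  \<open>z * cnj (z - a)\<close> in norm. Hence the Blaschke factor of \<open>a\<close> has modulus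
  one there.\<close>

lemma norm_blaschke_factor_on_circle:
  assumes "norm z = R"
  shows "norm (of_real (R\<^sup>2) - cnj a * z) = R * norm (z - a)"
proof -
  have "of_real (R\<^sup>2) = z * cnj z"
    by (simp only: complex_norm_square assms[symmetric])
  then have "of_real (R\<^sup>2) - cnj a * z = z * cnj (z - a)"
    by (simp add: algebra_simps)
  then show ?thesis
    by (simp only: norm_mult complex_mod_cnj assms)
qed

text \<open>Induction on the set of zeros: dividing by one Blaschke factor keeps the function
  holomorphic, its bound on the circle and its other zeros. Once no zero is left, the maximum
  modulus principle applies.\<close>

lemma blaschke_bound:
  fixes G :: "complex \<Rightarrow> complex"
  assumes "finite Z" "G holomorphic_on S" "open S" "cball 0 R \<subseteq> S" "0 < R" "Z \<subseteq> ball 0 R"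
    and "\<And>z. norm z = R \<Longrightarrow> norm (G z) \<le> B" and "\<And>z. z \<in> Z \<Longrightarrow> G z = 0" and "norm w < R"
  shows "norm (G w) \<le> B * (\<Prod>z\<in>Z. R * norm (w - z) / norm (of_real (R\<^sup>2) - cnj z * w))"
  using assms
proof (induction Z arbitrary: G rule: finite_induct)
  case empty
  have "norm (G w) \<le> B"
  proof (rule maximum_modulus_frontier[of G "ball 0 R"])
    have "ball 0 R \<subseteq> S" using empty by (meson ball_subset_cball order_trans)
    then show "G holomorphic_on interior (ball 0 R)"
      using empty by (auto intro: holomorphic_on_subset)
    show "continuous_on (closure (ball 0 R)) G"
      using empty by (auto intro: holomorphic_on_imp_continuous_on holomorphic_on_subset)
    show "norm (G z) \<le> B" if "z \<in> frontier (ball 0 R)" for z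
      using empty that by simp
  qed (use empty in auto)
  then show ?case by simp
next
  case (insert a Z)
  \<comment> \<open>The quotient of \<open>G\<close> by \<open>z - a\<close> with its removable
    singularity filled in, in the form that \<open>pole_lemma_open\<close> expects.\<close>
  define k where "k = (\<lambda>z. if z = a then deriv G a else (G z - G a) / (z - a))"
  define G1 where "G1 = (\<lambda>z. k z * ((of_real (R\<^sup>2) - cnj a * z) / of_real R))"
  have Ga: "G a = 0" using insert.prems by simp
  have na: "norm a < R" using insert.prems by auto
  have nz: "of_real (R\<^sup>2) - cnj a * z \<noteq> 0" if "norm z \<le> R" for z
  proof
    assume "of_real (R\<^sup>2) - cnj a * z = 0"
    then have "cnj a * z = of_real (R\<^sup>2)" by simp
    then have "norm (cnj a * z) = norm (of_real (R\<^sup>2) :: complex)" by (rule arg_cong)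
    then have "norm a * norm z = R * R"
      by (simp only: norm_mult norm_of_real complex_mod_cnj) (simp add: power2_eq_square)
    moreover have "norm a * norm z \<le> norm a * R" using that by (intro mult_left_mono) auto
    moreover have "norm a * R < R * R" using na \<open>0 < R\<close> by simp
    ultimately show False by linarith
  qed
  have G: "G z = (z - a) * R / (of_real (R\<^sup>2) - cnj a * z) * G1 z" if "norm z \<le> R" for z
    using nz[OF that] Ga \<open>0 < R\<close> by (auto simp: G1_def k_def)
  have "norm (G1 w) \<le> B * (\<Prod>z\<in>Z. R * norm (w - z) / norm (of_real (R\<^sup>2) - cnj z * w))"
  proof (rule insert.IH)
    have "k holomorphic_on S"
      unfolding k_def using insert.prems by (intro pole_lemma_open) auto
    then show "G1 holomorphic_on S"
      unfolding G1_def using \<open>0 < R\<close> by (intro holomorphic_intros) auto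
    show "norm (G1 z) \<le> B" if z: "norm z = R" for z
    proof -
      have "norm (z - a) > 0" using z na by auto
      then have "norm (G z) = norm (G1 z)"
        using G[of z] z \<open>0 < R\<close>
        by (simp add: norm_mult norm_divide norm_blaschke_factor_on_circle[OF z] del: of_real_power)
      then show ?thesis using insert.prems z by metis
    qed
    show "G1 z = 0" if "z \<in> Z" for z
      using that insert by (auto simp: G1_def k_def)
  qed (use insert.prems in auto)
  moreover have "norm (G w) = R * norm (w - a) / norm (of_real (R\<^sup>2) - cnj a * w) * norm (G1 w)"
    using G[of w] insert.prems by (simp add: norm_mult norm_divide mult.commute del: of_real_power)
  ultimately show ?case
    using insert.hyps insert.prems
    by (simp add: mult.left_commute mult_left_mono divide_nonneg_nonneg del: of_real_power)
       (smt (verit) mult.assoc mult.commute mult_left_mono divide_nonneg_nonneg mult_nonneg_nonneg norm_ge_zero times_divide_eq_right times_divide_eq_left)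
qed

text \<open>The extreme case is one point at 0 and the other at \<open>r\<close>, where equality
  holds. By symmetry the larger point may be called \<open>u\<close>, which reduces the claim to
  \<open>u \<le> r\<close> and \<open>r * u \<le> R\<^sup>2\<close>.\<close>

lemma blaschke_factor_le:
  fixes w z r R :: real
  assumes "0 \<le> z" "z \<le> r" "0 \<le> w" "w \<le> r" "r < R"  "R \<le> 1"
  shows "R * \<bar>w - z\<bar> / (R\<^sup>2 - z * w) \<le> r / R"
proof -
  have main: "R * (u - v) * R \<le> r * (R\<^sup>2 - u * v)" if "0 \<le> u" "u \<le> r" "0 \<le> v" for u v
  proof -
    have "R * R * u \<le> R * R * r" using that by (intro mult_left_mono) auto
    moreover have "v * (r * u) \<le> v * (R * R)"
      using that assms by (intro mult_left_mono mult_mono) auto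
    ultimately show ?thesis by (simp add: algebra_simps power2_eq_square)
  qed
  have "z * w \<le> r * r" using assms by (intro mult_mono) auto
  also have "r * r < R * R" using assms by (intro mult_strict_mono) auto
  finally have "0 < R\<^sup>2 - z * w" by (simp add: power2_eq_square)
  moreover have "R > 0" using assms by simp
  ultimately show ?thesis
    using main[of w z] main[of z w] assms
    by (cases "w \<ge> z") (auto simp: divide_simps mult.commute)
qed

lemma blaschke_bound_real:
  fixes G :: "complex \<Rightarrow> complex" and Z :: "real set"
  assumes Z: "finite Z" "Z \<subseteq> {0..r}" and G: "G holomorphic_on ball 0 1" and R: "r < R" "R < 1"
    and B: "\<And>z. norm z = R \<Longrightarrow> norm (G z) \<le> B"
    and G0: "\<And>z. z \<in> Z \<Longrightarrow> G (of_real z) = 0" and w: "0 \<le> w" "w \<le> r"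
  shows "norm (G (of_real w)) \<le> B * (r / R) ^ card Z"
proof -
  have "norm (G (of_real R)) \<le> B" using B R w by simp
  then have B0: "0 \<le> B" by (rule order_trans[OF norm_ge_zero])
  have "norm (G w) \<le> B * (\<Prod>z\<in>complex_of_real ` Z. R * norm (w - z) / norm (of_real (R\<^sup>2) - cnj z * w))"
    using assms by (intro blaschke_bound[of _ _ "ball 0 1"]) auto
  also have "(\<Prod>z\<in>complex_of_real ` Z. R * norm (w - z) / norm (of_real (R\<^sup>2) - cnj z * w))
      = (\<Prod>z\<in>Z. R * norm (complex_of_real w - of_real z) / norm (of_real (R\<^sup>2) - cnj (of_real z) * complex_of_real w))"
    by (subst prod.reindex) (auto simp: inj_on_def)
  also have "\<dots> = (\<Prod>z\<in>Z. R * \<bar>w - z\<bar> / \<bar>R\<^sup>2 - z * w\<bar>)"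
    by (intro prod.cong refl) (simp only: complex_cnj_complex_of_real of_real_mult[symmetric] of_real_diff[symmetric] norm_of_real)
  also have "\<dots> \<le> (\<Prod>z\<in>Z. r / R)"
  proof (intro prod_mono conjI)
    fix z assume z: "z \<in> Z"
    have "z * w \<le> R * R" using z Z w R by (intro mult_mono) auto
    then have "\<bar>R\<^sup>2 - z * w\<bar> = R\<^sup>2 - z * w" by (simp add: power2_eq_square)
    then show "R * \<bar>w - z\<bar> / \<bar>R\<^sup>2 - z * w\<bar> \<le> r / R"
      using blaschke_factor_le[of z r w R] z Z w R by auto
  qed (use w R in auto)
  also have "\<dots> = (r / R) ^ card Z" by simp
  finally show ?thesis using B0 by (simp add: mult_left_mono)
qed

section \<open>Integer polynomials in two variables\<close>

definition bipoly :: "nat \<Rightarrow> nat \<Rightarrow> (nat \<times> nat \<Rightarrow> int) \<Rightarrow> complex \<Rightarrow> complex \<Rightarrow> complex" where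
  "bipoly n l p z w = (\<Sum>(i, j)\<in>{..<n} \<times> {..<l}. of_int (p (i, j)) * z ^ i * w ^ j)"

lemma bipoly_holomorphic:
  assumes "f holomorphic_on S"
  shows "(\<lambda>z. bipoly n l p z (f z)) holomorphic_on S"
  unfolding bipoly_def case_prod_unfold using assms by (intro holomorphic_intros)

lemma norm_bipoly_le:
  assumes p: "\<And>ij. ij \<in> {..<n} \<times> {..<l} \<Longrightarrow> real_of_int \<bar>p ij\<bar> \<le> X"
    and z: "norm z \<le> 1" and w: "norm w \<le> M" and M: "M \<ge> 1"
  shows "norm (bipoly n l p z w) \<le> real n * real l * X * M ^ l"
proof -
  have "norm (bipoly n l p z w) \<le> (\<Sum>(i, j)\<in>{..<n} \<times> {..<l}. X * M ^ l)"
    unfolding bipoly_def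
  proof (rule sum_norm_le, clarsimp)
    fix i j assume ij: "i < n" "j < l"
    have "norm w ^ j \<le> M ^ j" using w by (intro power_mono) auto
    also have "\<dots> \<le> M ^ l" using ij M by (intro power_increasing) auto
    finally have "norm w ^ j \<le> M ^ l" .
    moreover have "\<bar>p (i, j)\<bar> * norm z ^ i \<le> X * 1"
      using p[of "(i, j)"] ij z by (intro mult_mono power_le_one) auto
    moreover have "0 \<le> X" using p[of "(i, j)"] ij by auto
    ultimately show "norm (of_int (p (i, j)) * z ^ i * w ^ j) \<le> X * M ^ l"
      by (simp add: norm_mult norm_power) (intro mult_mono, auto)
  qed
  then show ?thesis by simp
qed

text \<open>The integer is given explicitly because its coefficients, the factors of
  \<open>p ij\<close>, become the entries of the linear system in
  \<open>vanishing_polynomial\<close>.\<close>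

lemma bipoly_rational:
  fixes m d u t :: int
  assumes "d \<noteq> 0" "t \<noteq> 0"
  shows "bipoly n l p (of_int m / of_int d) (of_int u / of_int t) * of_int d ^ n * of_int t ^ l
    = of_int (\<Sum>ij\<in>{..<n} \<times> {..<l}. (m ^ fst ij * d ^ (n - fst ij) * u ^ snd ij * t ^ (l - snd ij)) * p ij)"
  unfolding bipoly_def sum_distrib_right of_int_sum
proof (rule sum.cong, goal_cases)
  case (2 ij)
  have "of_int d ^ n = (of_int d :: complex) ^ fst ij * of_int d ^ (n - fst ij)"
    "of_int t ^ l = (of_int t :: complex) ^ snd ij * of_int t ^ (l - snd ij)"
    using 2 by (auto simp flip: power_add)
  then show ?case using assms
    by (simp add: case_prod_unfold power_divide)
qed simp

text \<open>Clearing denominators turns the value into a nonzero integer, which has absolute value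
  at least 1.\<close>

lemma norm_bipoly_rational_ge:
  fixes m d u t h :: int
  assumes "0 < d" "0 < t" "d \<le> h" "t \<le> h"
    and nz: "bipoly n l p (of_int m / of_int d) (of_int u / of_int t) \<noteq> 0"
  shows "1 \<le> norm (bipoly n l p (of_int m / of_int d) (of_int u / of_int t)) * real_of_int h ^ (n + l)"
proof -
  let ?y = "bipoly n l p (of_int m / of_int d) (of_int u / of_int t)"
  obtain k :: int where k: "?y * of_int d ^ n * of_int t ^ l = of_int k"
    using bipoly_rational[of d t n l p m u] assms(1,2) by blast
  then have "k \<noteq> 0" using assms by auto
  then have "1 \<le> norm (of_int k :: complex)" by simp
  also have "\<dots> = norm ?y * (real_of_int d ^ n * real_of_int t ^ l)"
    using assms by (simp add: norm_mult norm_power flip: k)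
  also have "\<dots> \<le> norm ?y * (real_of_int h ^ n * real_of_int h ^ l)"
    using assms by (intro mult_left_mono mult_mono power_mono) auto
  finally show ?thesis by (simp add: power_add)
qed

text \<open>The \<open>n\<close> candidates give \<open>n\<close> distinct points
  \<open>1 - 1 / v\<close>, more than the roots of a nonzero polynomial of degree below
  \<open>n\<close>.\<close>

lemma ex_reciprocal_nonroot:
  fixes c :: "nat \<Rightarrow> int"
  assumes "i < n" "c i \<noteq> 0" "V \<ge> 1"
  obtains v where "V \<le> v" "v < V + n" "(\<Sum>i<n. of_int (c i) * (1 - 1 / real v) ^ i) \<noteq> 0"
proof (rule ccontr)
  assume "\<not> thesis"
  then have root: "(\<Sum>i<n. of_int (c i) * (1 - 1 / real v) ^ i) = 0" if "V \<le> v" "v < V + n" for v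
    using that \<open>\<And>v. V \<le> v \<Longrightarrow> v < V + n \<Longrightarrow> _ \<Longrightarrow> thesis\<close> by blast
  obtain N where N: "n = Suc N" using assms by (cases n) auto
  define R where "R = {z::real. (\<Sum>i\<le>N. of_int (c i) * z ^ i) = 0}"
  have R: "finite R" "card R \<le> N"
    using polyfun_rootbound[of N "\<lambda>i. real_of_int (c i)"] assms N by (auto simp: R_def less_Suc_eq_le)
  have "(\<lambda>v. 1 - 1 / real v) ` {V..<V + n} \<subseteq> R"
    using root by (auto simp: R_def N lessThan_Suc_atMost)
  then have "card ((\<lambda>v. 1 - 1 / real v) ` {V..<V + n}) \<le> N"
    using R card_mono order_trans by blast
  moreover have "inj_on (\<lambda>v. 1 - 1 / real v) {V..<V + n}"
    using assms by (auto simp: inj_on_def)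
  ultimately show False using N by (simp add: card_image)
qed

lemma polynomial_reciprocal_ge:
  fixes c :: "nat \<Rightarrow> int"
  assumes nz: "(\<Sum>i<n. of_int (c i) * (1 - 1 / real v) ^ i) \<noteq> 0" and v: "v \<ge> 1"
  shows "1 / real v ^ n \<le> \<bar>\<Sum>i<n. of_int (c i) * (1 - 1 / real v) ^ i\<bar>"
proof -
  let ?y = "\<Sum>i<n. of_int (c i) * (1 - 1 / real v) ^ i"
  define k where "k = (\<Sum>i<n. c i * (int v - 1) ^ i * int v ^ (n - i))"
  have "?y * real v ^ n = of_int k"
    unfolding k_def of_int_sum sum_distrib_right
  proof (rule sum.cong)
    fix i assume i: "i \<in> {..<n}"
    have "1 - 1 / real v = (real v - 1) / real v" using v by (simp add: field_simps)
    moreover have "real v ^ n = real v ^ i * real v ^ (n - i)" using i by (simp flip: power_add)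
    ultimately show "of_int (c i) * (1 - 1 / real v) ^ i * real v ^ n
        = of_int (c i * (int v - 1) ^ i * int v ^ (n - i))"
      using v by (simp add: power_divide)
  qed simp
  moreover from this have "k \<noteq> 0" using nz v by auto
  then have "1 \<le> \<bar>real_of_int k\<bar>" by simp
  ultimately have "1 \<le> \<bar>?y * real v ^ n\<bar>" by (simp only:)
  then have "1 \<le> \<bar>?y\<bar> * real v ^ n" by (simp only: abs_mult power_abs abs_of_nat)
  then show ?thesis using v by (simp add: divide_simps)
qed

text \<open>Let \<open>k\<close> be the degree in \<open>w\<close>. Its coefficient polynomial is
  nonzero, so at a suitable \<open>1 - 1 / v\<close> it is at least \<open>1 / v ^ n\<close> in
  absolute value. For \<open>w\<close> as large as assumed, the lower terms together are at most
  half of the top term.\<close>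

lemma bipoly_ge_at_reciprocal:
  fixes p :: "nat \<times> nat \<Rightarrow> int" and X :: real
  assumes ne: "\<exists>ij\<in>{..<n} \<times> {..<l}. p ij \<noteq> 0"
    and p: "\<And>ij. ij \<in> {..<n} \<times> {..<l} \<Longrightarrow> real_of_int \<bar>p ij\<bar> \<le> X" and V: "V \<ge> 1"
  shows "\<exists>v. V \<le> v \<and> v < V + n \<and>
    (\<forall>w. norm w \<ge> 1 \<longrightarrow> norm w \<ge> 2 * real n * real l * X * real v ^ n \<longrightarrow>
       norm (bipoly n l p (of_real (1 - 1 / real v)) w) \<ge> 1 / (2 * real v ^ n))"
proof -
  define k where "k = Max {j. j < l \<and> (\<exists>i<n. p (i, j) \<noteq> 0)}"
  have "k \<in> {j. j < l \<and> (\<exists>i<n. p (i, j) \<noteq> 0)}"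
    unfolding k_def using ne by (intro Max_in) auto
  then obtain i where k: "k < l" "i < n" "p (i, k) \<noteq> 0" by auto
  have above: "p (i, j) = 0" if "k < j" "j < l" "i < n" for i j
    using Max_ge[of "{j. j < l \<and> (\<exists>i<n. p (i, j) \<noteq> 0)}" j] that unfolding k_def by fastforce
  obtain v where v: "V \<le> v" "v < V + n" "(\<Sum>i<n. of_int (p (i, k)) * (1 - 1 / real v) ^ i) \<noteq> 0"
    using ex_reciprocal_nonroot[of i n "\<lambda>i. p (i, k)" V] k V by metis
  define x where "x = 1 - 1 / real v"
  have v1: "v \<ge> 1" using v V by simp
  have x: "0 \<le> x" "x \<le> 1" using v1 by (auto simp: x_def)
  define c where "c = (\<lambda>j. \<Sum>i<n. of_int (p (i, j)) * x ^ i)"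
  have X0: "X \<ge> 0" using p[of "(i, k)"] k by auto
  have c_le: "\<bar>c j\<bar> \<le> real n * X" if "j < l" for j
  proof -
    have "\<bar>c j\<bar> \<le> (\<Sum>i<n. X)"
      unfolding c_def
    proof (rule order_trans[OF sum_abs sum_mono])
      fix i assume "i \<in> {..<n}"
      then have "real_of_int \<bar>p (i, j)\<bar> * x ^ i \<le> X * 1"
        using p[of "(i, j)"] that x by (intro mult_mono power_le_one) auto
      then show "\<bar>of_int (p (i, j)) * x ^ i\<bar> \<le> X" using x by (simp add: abs_mult)
    qed
    then show ?thesis by simp
  qed
  have ck: "1 / real v ^ n \<le> \<bar>c k\<bar>"
    using polynomial_reciprocal_ge[of "\<lambda>i. p (i, k)" v n] v v1 by (simp add: c_def x_def)
  show ?thesis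
  proof (intro exI[of _ v] conjI allI impI v(1,2))
    fix w :: complex
    assume w1: "norm w \<ge> 1" and w: "norm w \<ge> 2 * real n * real l * X * real v ^ n"
    have "bipoly n l p (of_real x) w = (\<Sum>i<n. \<Sum>j<l. of_int (p (i, j)) * of_real x ^ i * w ^ j)"
      by (simp add: bipoly_def sum.cartesian_product)
    also have "\<dots> = (\<Sum>j<l. of_real (c j) * w ^ j)"
      by (subst sum.swap) (simp add: c_def sum_distrib_right)
    also have "\<dots> = (\<Sum>j\<le>k. of_real (c j) * w ^ j)"
      using k(1) above by (intro sum.mono_neutral_right) (auto simp: c_def not_le)
    also have "\<dots> = (\<Sum>j<k. of_real (c j) * w ^ j) + of_real (c k) * w ^ k"
      by (simp flip: lessThan_Suc_atMost)
    finally have eq: "bipoly n l p (of_real x) w = (\<Sum>j<k. of_real (c j) * w ^ j) + of_real (c k) * w ^ k" .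
    \<comment> \<open>Every lower term loses at least one factor \<open>norm w\<close> against
      \<open>w ^ k\<close>; the assumed size of \<open>w\<close> makes up for the number of terms,
      their coefficients and the factor \<open>2 * v ^ n\<close>.\<close>
    have "norm (\<Sum>j<k. of_real (c j) * w ^ j) \<le> (\<Sum>j<k. real n * X * norm w ^ k / norm w)"
    proof (rule sum_norm_le)
      fix j assume j: "j \<in> {..<k}"
      have "norm w ^ j * norm w = norm w ^ Suc j" by simp
      also have "\<dots> \<le> norm w ^ k" using j w1 by (intro power_increasing) auto
      finally have "norm w ^ j \<le> norm w ^ k / norm w" using w1 by (subst pos_le_divide_eq) auto
      then have "\<bar>c j\<bar> * norm w ^ j \<le> (real n * X) * (norm w ^ k / norm w)"
        using c_le[of j] j k X0 by (intro mult_mono) auto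
      then show "norm (of_real (c j) * w ^ j) \<le> real n * X * norm w ^ k / norm w"
        by (simp add: norm_mult norm_power)
    qed
    also have "\<dots> = real k * (real n * X * norm w ^ k / norm w)" by simp
    also have "\<dots> \<le> real l * (real n * X * norm w ^ k / norm w)"
      using k X0 by (intro mult_right_mono divide_nonneg_nonneg mult_nonneg_nonneg) auto
    also have "\<dots> = norm w ^ k * ((real n * real l * X) / norm w)" by (simp add: field_simps)
    also have "\<dots> \<le> norm w ^ k * (1 / (2 * real v ^ n))"
    proof (intro mult_left_mono)
      show "real n * real l * X / norm w \<le> 1 / (2 * real v ^ n)"
        using w w1 v1 by (subst pos_divide_le_eq) (auto simp: field_simps)
    qed auto
    finally have small: "norm (\<Sum>j<k. of_real (c j) * w ^ j) \<le> norm w ^ k * (1 / (2 * real v ^ n))" .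
    have "norm (of_real (c k) * w ^ k) = norm w ^ k * \<bar>c k\<bar>" by (simp add: norm_mult norm_power)
    moreover have "norm w ^ k * (1 / real v ^ n) \<le> norm w ^ k * \<bar>c k\<bar>"
      using ck by (intro mult_left_mono) auto
    moreover have "norm w ^ k * (1 / real v ^ n) = norm w ^ k * (1 / (2 * real v ^ n)) + norm w ^ k * (1 / (2 * real v ^ n))"
      by simp
    moreover have "norm (of_real (c k) * w ^ k) - norm (\<Sum>j<k. of_real (c j) * w ^ j) \<le> norm (bipoly n l p (of_real x) w)"
      unfolding eq by (metis add.commute norm_diff_ineq)
    ultimately have "norm w ^ k * (1 / (2 * real v ^ n)) \<le> norm (bipoly n l p (of_real x) w)"
      using small by linarith
    moreover have "1 * (1 / (2 * real v ^ n)) \<le> norm w ^ k * (1 / (2 * real v ^ n))"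
      using w1 by (intro mult_right_mono one_le_power) auto
    ultimately show "norm (bipoly n l p (of_real (1 - 1 / real v)) w) \<ge> 1 / (2 * real v ^ n)"
      by (simp add: x_def)
  qed
qed

section \<open>The auxiliary polynomial\<close>

lemma of_real_of_rat: "complex_of_real (of_rat q) = of_rat q"
  by (cases q) (simp add: of_rat_rat)

lemma rat_height_cases:
  obtains m d where "(of_rat q :: complex) = of_int m / of_int d" "q = Fract m d" "0 < d" "d \<le> mult_height q" "\<bar>m\<bar> \<le> mult_height q"
proof -
  obtain m d where md: "quotient_of q = (m, d)" by (cases "quotient_of q")
  then have "0 < d" by (rule quotient_of_denom_pos)
  moreover have "q = of_int m / of_int d" using md by (rule quotient_of_div)
  then have "(of_rat q :: complex) = of_int m / of_int d" by (simp add: of_rat_divide)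
  moreover have "q = Fract m d" using \<open>q = of_int m / of_int d\<close> by (simp add: Fract_of_int_quotient)
  ultimately show thesis using that[of m d] md by (simp add: mult_height_def)
qed

lemma norm_of_rat_le_height: "norm (of_rat r :: complex) \<le> mult_height r"
proof -
  obtain m d where md: "(of_rat r :: complex) = of_int m / of_int d" "r = Fract m d" "0 < d" "d \<le> mult_height r" "\<bar>m\<bar> \<le> mult_height r"
    by (rule rat_height_cases)
  have "norm (of_rat r :: complex) = \<bar>of_int m\<bar> / of_int d"
    using md by (simp add: norm_divide)
  also have "\<dots> \<le> \<bar>of_int m\<bar> / 1" using md by (intro divide_left_mono) auto
  also have "\<dots> \<le> mult_height r" using md by simp
  finally show ?thesis .
qed

lemma finite_height_le: "finite {q. mult_height q \<le> h}"
proof (rule finite_subset)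
  show "{q. mult_height q \<le> h} \<subseteq> (\<lambda>(m, d). Fract m d) ` ({-h..h} \<times> {-h..h})"
  proof
    fix q assume q: "q \<in> {q. mult_height q \<le> h}"
    obtain m d where "(of_rat q :: complex) = of_int m / of_int d" "q = Fract m d" "0 < d" "d \<le> mult_height q" "\<bar>m\<bar> \<le> mult_height q"
      by (rule rat_height_cases)
    then show "q \<in> (\<lambda>(m, d). Fract m d) ` ({-h..h} \<times> {-h..h})"
      using q by (intro image_eqI[of _ _ "(m, d)"]) auto
  qed
qed simp

text \<open>The quotient equals \<open>1 - 1 / (2 * D - 1)\<close>. It is the gain per zero when the
  zeros stay at distance \<open>1 / D\<close> from the unit circle and the circle of radius
  \<open>R\<close> runs halfway between.\<close>

lemma blaschke_ratio_power_le:
  fixes D :: real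
  assumes "D \<ge> 1"
  shows "((1 - 1 / D) / (1 - 1 / (2 * D))) ^ n \<le> exp (- (real n / (2 * D)))"
proof -
  have "(1 - 1 / D) / (1 - 1 / (2 * D)) \<le> 1 + - 1 / (2 * D)"
    using assms by (simp add: divide_simps) (simp add: algebra_simps)
  also have "\<dots> \<le> exp (- 1 / (2 * D))" by (rule exp_ge_add_one_self)
  finally have "((1 - 1 / D) / (1 - 1 / (2 * D))) ^ n \<le> exp (- 1 / (2 * D)) ^ n"
    using assms by (intro power_mono) auto
  also have "\<dots> = exp (- (real n / (2 * D)))" by (simp flip: exp_of_nat_mult)
  finally show ?thesis .
qed

text \<open>There are \<open>2 * T\<^sup>2\<close> coefficients and \<open>T\<^sup>2\<close> points
  in \<open>S0\<close>, so Siegel's lemma makes the polynomial vanish on \<open>S0\<close>. A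
  nonzero value at another point of \<open>S\<close> would be at least
  \<open>1 / h ^ (3 * T)\<close>, while the Blaschke bound with the zeros in \<open>S0\<close> is
  smaller than that by \<open>small\<close>.\<close>

lemma vanishing_polynomial:
  fixes f :: "complex \<Rightarrow> complex" and S :: "rat set" and h :: int and T :: nat and D M :: real
  assumes f: "f holomorphic_on ball 0 1" and T: "T \<ge> 1" and h: "h \<ge> 1" and D: "D \<ge> 2"
    and S: "T\<^sup>2 \<le> card S"
      "\<And>q. q \<in> S \<Longrightarrow> 0 < q \<and> real_of_rat q \<le> 1 - 1 / D \<and> mult_height q \<le> h"
      "\<And>q. q \<in> S \<Longrightarrow> \<exists>r. f (of_rat q) = of_rat r \<and> mult_height r \<le> h"
    and M: "\<And>z. norm z = 1 - 1 / (2 * D) \<Longrightarrow> norm (f z) \<le> M" "M \<ge> 1"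
    and small: "(2 * real T ^ 2)\<^sup>2 * of_int h ^ (6 * T) * M ^ T < exp (real T ^ 2 / (2 * D))"
  obtains p where "\<exists>ij\<in>{..<2 * T} \<times> {..<T}. p ij \<noteq> 0"
    "\<And>ij. ij \<in> {..<2 * T} \<times> {..<T} \<Longrightarrow> real_of_int \<bar>p ij\<bar> \<le> 2 * real T ^ 2 * of_int h ^ (3 * T)"
    "\<And>q. q \<in> S \<Longrightarrow> bipoly (2 * T) T p (of_rat q) (f (of_rat q)) = 0"
proof -
  obtain S0 where S0: "S0 \<subseteq> S" "card S0 = T\<^sup>2" "finite S0"
    using S(1) by (rule obtain_subset_with_card_n)
  have "\<forall>q\<in>S. \<exists>m d u t. of_rat q = (of_int m / of_int d :: complex) \<and> f (of_rat q) = of_int u / of_int t \<and>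
      0 < d \<and> d \<le> h \<and> \<bar>m\<bar> \<le> h \<and> 0 < t \<and> t \<le> h \<and> \<bar>u\<bar> \<le> h"
  proof
    fix q assume q: "q \<in> S"
    obtain r where r: "f (of_rat q) = of_rat r" "mult_height r \<le> h" using S(3) q by blast
    obtain m d where "(of_rat q :: complex) = of_int m / of_int d" "0 < d" "d \<le> mult_height q" "\<bar>m\<bar> \<le> mult_height q"
      by (rule rat_height_cases)
    moreover obtain u t where "(of_rat r :: complex) = of_int u / of_int t" "0 < t" "t \<le> mult_height r" "\<bar>u\<bar> \<le> mult_height r"
      by (rule rat_height_cases)
    ultimately show "\<exists>m d u t. of_rat q = (of_int m / of_int d :: complex) \<and> f (of_rat q) = of_int u / of_int t \<and>
      0 < d \<and> d \<le> h \<and> \<bar>m\<bar> \<le> h \<and> 0 < t \<and> t \<le> h \<and> \<bar>u\<bar> \<le> h"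
      using r S(2)[OF q] by (metis order_trans)
  qed
  then obtain m d u t where
    fr: "\<And>q. q \<in> S \<Longrightarrow> of_rat q = (of_int (m q) / of_int (d q) :: complex)"
      "\<And>q. q \<in> S \<Longrightarrow> f (of_rat q) = of_int (u q) / of_int (t q)"
    and pos: "\<And>q. q \<in> S \<Longrightarrow> 0 < d q" "\<And>q. q \<in> S \<Longrightarrow> 0 < t q"
    and le: "\<And>q. q \<in> S \<Longrightarrow> d q \<le> h" "\<And>q. q \<in> S \<Longrightarrow> \<bar>m q\<bar> \<le> h"
      "\<And>q. q \<in> S \<Longrightarrow> t q \<le> h" "\<And>q. q \<in> S \<Longrightarrow> \<bar>u q\<bar> \<le> h"
    unfolding bchoice_iff by blast
  define I where "I = {..<2 * T} \<times> {..<T}"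
  define A where "A = (\<lambda>q ij. m q ^ fst ij * d q ^ (2 * T - fst ij) * u q ^ snd ij * t q ^ (T - snd ij))"
  have cardI: "card I = 2 * T\<^sup>2" by (simp add: I_def power2_eq_square)
  have fin: "finite I" by (simp add: I_def)
  have "card S0 > 0" using S0 T by simp
  then have ne: "S0 \<noteq> {}" by auto
  have card_eq: "card I = 2 * card S0" using cardI S0 by simp
  have A_le: "\<bar>A q ij\<bar> \<le> h ^ (3 * T)" if "q \<in> S0" "ij \<in> I" for q ij
  proof -
    have q: "q \<in> S" using that S0 by auto
    have "\<bar>A q ij\<bar> = \<bar>m q\<bar> ^ fst ij * \<bar>d q\<bar> ^ (2 * T - fst ij) * \<bar>u q\<bar> ^ snd ij * \<bar>t q\<bar> ^ (T - snd ij)"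
      by (simp add: A_def abs_mult power_abs)
    also have "\<dots> \<le> h ^ fst ij * h ^ (2 * T - fst ij) * h ^ snd ij * h ^ (T - snd ij)"
      using le[OF q] pos[OF q] h by (intro mult_mono power_mono mult_nonneg_nonneg zero_le_power) auto
    also have "\<dots> = h ^ (fst ij + (2 * T - fst ij) + snd ij + (T - snd ij))"
      by (simp only: power_add)
    also have "fst ij + (2 * T - fst ij) + snd ij + (T - snd ij) = 3 * T"
      using that by (auto simp: I_def)
    finally show ?thesis .
  qed
  have hT: "h ^ (3 * T) \<ge> 1" using h by simp
  have "\<exists>p. (\<exists>i\<in>I. p i \<noteq> 0) \<and> (\<forall>i\<in>I. \<bar>p i\<bar> \<le> int (card I) * h ^ (3 * T)) \<and>
      (\<forall>j\<in>S0. (\<Sum>i\<in>I. A j i * p i) = 0)"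
    by (intro siegel_integer_solution fin S0(3) ne card_eq A_le hT)
  then obtain p where p: "\<exists>i\<in>I. p i \<noteq> 0" "\<And>i. i \<in> I \<Longrightarrow> \<bar>p i\<bar> \<le> int (card I) * h ^ (3 * T)"
    "\<And>j. j \<in> S0 \<Longrightarrow> (\<Sum>i\<in>I. A j i * p i) = 0"
    by blast
  have p_le: "real_of_int \<bar>p ij\<bar> \<le> 2 * real T ^ 2 * of_int h ^ (3 * T)" if "ij \<in> I" for ij
  proof -
    have "real_of_int \<bar>p ij\<bar> \<le> real_of_int (int (card I) * h ^ (3 * T))"
      using p(2)[OF that] by (simp only: of_int_le_iff)
    then show ?thesis by (simp add: cardI)
  qed
  define G where "G = (\<lambda>z. bipoly (2 * T) T p z (f z))"
  have zero: "G (of_rat q) = 0" if "q \<in> S0" for q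
  proof -
    have q: "q \<in> S" using that S0 by auto
    have "G (of_rat q) = bipoly (2 * T) T p (of_int (m q) / of_int (d q)) (of_int (u q) / of_int (t q))"
      by (simp only: G_def fr(2)[OF q]) (simp only: fr(1)[OF q])
    then have "G (of_rat q) * of_int (d q) ^ (2 * T) * of_int (t q) ^ T = of_int (\<Sum>ij\<in>I. A q ij * p ij)"
      using bipoly_rational[of "d q" "t q" "2 * T" T p "m q" "u q"] pos[OF q] by (simp add: A_def I_def)
    then have "G (of_rat q) * of_int (d q) ^ (2 * T) * of_int (t q) ^ T = 0"
      using p(3)[OF that] by simp
    then show ?thesis using pos[OF q] by simp
  qed
  define R where "R = 1 - 1 / (2 * D)"
  have R: "1 - 1 / D < R" "R < 1" "0 \<le> R" using D by (auto simp: R_def field_simps)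
  have vanish: "G (of_rat q) = 0" if q: "q \<in> S" for q
  proof (rule ccontr)
    assume "G (of_rat q) \<noteq> 0"
    then have ge: "1 \<le> norm (G (of_rat q)) * real_of_int h ^ (3 * T)"
      using norm_bipoly_rational_ge[of "d q" "t q" h "2 * T" T p "m q" "u q"] pos[OF q] le[OF q]
      by (simp add: G_def fr(2)[OF q]) (simp add: fr(1)[OF q])
    define X where "X = 2 * real T ^ 2 * of_int h ^ (3 * T)"
    \<comment> \<open>The number of coefficients times their bound \<open>X\<close> times
      \<open>M ^ T\<close>. One factor \<open>h ^ (3 * T)\<close> sits in \<open>X\<close> and
      another comes from the denominators, hence the exponent \<open>6 * T\<close> in
      \<open>small\<close>.\<close>
    define Bd where "Bd = real (2 * T) * real T * X * M ^ T"
    have Bd0: "Bd \<ge> 0" using h M by (simp add: Bd_def X_def)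
    have "norm (G (complex_of_real (of_rat q))) \<le> Bd * ((1 - 1 / D) / R) ^ card (real_of_rat ` S0)"
    proof (rule blaschke_bound_real)
      show "G holomorphic_on ball 0 1" unfolding G_def using f by (rule bipoly_holomorphic)
      show "norm (G z) \<le> Bd" if "norm z = R" for z
        unfolding G_def Bd_def
        using that R M p_le by (intro norm_bipoly_le) (auto simp: R_def X_def I_def)
      show "real_of_rat ` S0 \<subseteq> {0..1 - 1 / D}" using S(2) S0(1) by (fastforce simp: zero_le_of_rat_iff)
    qed (use S(2)[OF q] S0 R zero in \<open>auto simp: less_imp_le of_real_of_rat\<close>)
    also have "complex_of_real (of_rat q) = of_rat q" by (rule of_real_of_rat)
    also have "card (real_of_rat ` S0) = T\<^sup>2" using S0 by (simp add: card_image inj_on_def)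
    finally have "norm (G (of_rat q)) \<le> Bd * exp (- (real (T\<^sup>2) / (2 * D)))"
      using blaschke_ratio_power_le[of D "T\<^sup>2"] D Bd0 unfolding R_def
      by (meson mult_left_mono order_trans one_le_numeral)
    then have "norm (G (of_rat q)) * real_of_int h ^ (3 * T) \<le> Bd * exp (- (real (T\<^sup>2) / (2 * D))) * real_of_int h ^ (3 * T)"
      using h by (intro mult_right_mono) auto
    then have "1 \<le> Bd * exp (- (real (T\<^sup>2) / (2 * D))) * real_of_int h ^ (3 * T)" using ge by simp
    then have "exp (real (T\<^sup>2) / (2 * D)) \<le> Bd * real_of_int h ^ (3 * T)"
      by (simp add: exp_minus field_simps)
    also have "\<dots> = (2 * real T ^ 2)\<^sup>2 * (of_int h ^ (3 * T) * of_int h ^ (3 * T)) * M ^ T"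
      by (simp add: Bd_def X_def power2_eq_square)
    also have "of_int h ^ (3 * T) * of_int h ^ (3 * T) = (of_int h ^ (6 * T) :: real)"
      by (simp flip: power_add)
    finally show False using small by simp
  qed
  show thesis using that[of p] p(1) p_le vanish by (auto simp: I_def G_def)
qed

text \<open>All points of \<open>Z\<close> are zeros of one function, so the Blaschke bound at
  \<open>1 - 1 / v\<close> decays exponentially in \<open>card Z\<close>; the lower bound
  \<open>ge\<close> limits this decay.\<close>

lemma zero_count:
  fixes f :: "complex \<Rightarrow> complex" and Z :: "real set" and M X :: real
  assumes f: "f holomorphic_on ball 0 1" and v: "v \<ge> (1::nat)"
    and p: "\<And>ij. ij \<in> {..<n} \<times> {..<l} \<Longrightarrow> real_of_int \<bar>p ij\<bar> \<le> X" and X: "X \<ge> 0"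
    and M: "\<And>z. norm z = 1 - 1 / (2 * real v) \<Longrightarrow> norm (f z) \<le> M" "M \<ge> 1"
    and Z: "finite Z" "Z \<subseteq> {0..1 - 1 / real v}"
      "\<And>z. z \<in> Z \<Longrightarrow> bipoly n l p (of_real z) (f (of_real z)) = 0"
    and ge: "norm (bipoly n l p (of_real (1 - 1 / real v)) (f (of_real (1 - 1 / real v)))) \<ge> 1 / (2 * real v ^ n)"
  shows "exp (real (card Z) / (2 * real v)) \<le> 2 * real v ^ n * (real n * real l * X * M ^ l)"
proof -
  define Bd where "Bd = real n * real l * X * M ^ l"
  define G where "G = (\<lambda>z. bipoly n l p z (f z))"
  have Bd0: "Bd \<ge> 0" using X M by (simp add: Bd_def)
  have "norm (G (of_real (1 - 1 / real v))) \<le> Bd * ((1 - 1 / real v) / (1 - 1 / (2 * real v))) ^ card Z"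
  proof (rule blaschke_bound_real)
    show "G holomorphic_on ball 0 1" unfolding G_def using f by (rule bipoly_holomorphic)
    show "norm (G z) \<le> Bd" if "norm z = 1 - 1 / (2 * real v)" for z
      unfolding G_def Bd_def using that M p by (intro norm_bipoly_le) auto
  qed (use v Z in \<open>auto simp: G_def field_simps\<close>)
  also have "\<dots> \<le> Bd * exp (- (real (card Z) / (2 * real v)))"
    using v Bd0 by (intro mult_left_mono blaschke_ratio_power_le) auto
  finally have "1 / (2 * real v ^ n) \<le> Bd * exp (- (real (card Z) / (2 * real v)))"
    using ge by (simp add: G_def)
  then show ?thesis using v by (simp add: Bd_def exp_minus field_simps)
qed

section \<open>Choice of parameters\<close>

lemma four_square_le_exp: "4 * real T ^ 2 \<le> exp (4 * real T)"
proof -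
  have "2 * real T \<le> exp (2 * real T)" using exp_ge_add_one_self[of "2 * real T"] by linarith
  then have "(2 * real T)\<^sup>2 \<le> exp (2 * real T) ^ 2" by (intro power_mono) auto
  also have "exp (2 * real T) ^ 2 = exp (4 * real T)" by (simp flip: exp_of_nat_mult)
  finally show ?thesis by (simp add: power_mult_distrib)
qed

lemma double_square_le_exp: "2 * real T ^ 2 \<le> exp (4 * real T)"
  using four_square_le_exp[of T] zero_le_power2[of "real T"] by linarith

lemma le_exp: "x \<le> exp (x::real)"
  using exp_ge_add_one_self[of x] by linarith

lemma exp_mult_power: "exp (x::real) ^ n = exp (real n * x)"
  by (simp flip: exp_of_nat_mult)

text \<open>The single parameter \<open>\<Lambda>\<close> stands for \<open>a\<close>,
  \<open>b\<close> and \<open>c0\<close>, and the growth conditions are weakened to exponentials, so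
  that all later bounds are monomials in \<open>\<Lambda>\<close> and \<open>L\<close>.\<close>

locale rational_points =
  fixes f :: "complex \<Rightarrow> complex" and \<Lambda> H L :: real and S :: "rat set"
  assumes f: "f holomorphic_on ball 0 1" and \<Lambda>: "\<Lambda> \<ge> 1" and H: "H \<ge> exp 1"
    and up: "\<And>z. 1 / 2 \<le> norm z \<Longrightarrow> norm z < 1 \<Longrightarrow> norm (f z) \<le> exp (\<Lambda> / (1 - norm z)\<^sup>2)"
    and low: "\<And>x::real. 0 < x \<Longrightarrow> x < 1 \<Longrightarrow> norm (f (of_real x)) \<ge> exp (1 / (2 * \<Lambda> * (1 - x))) / \<Lambda>"
  defines "L \<equiv> ln H"
  defines "S \<equiv> {q. 0 < q \<and> q < 1 \<and> of_int (mult_height q) \<le> H \<and>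
                 (\<exists>r. f (of_rat q) = of_rat r \<and> of_int (mult_height r) \<le> H)}"
begin

lemma L: "L \<ge> 1"
  unfolding L_def using H by (metis exp_gt_zero ln_exp ln_le_cancel_iff order_less_le_trans)

lemma exp_L: "exp L = H"
  unfolding L_def using H by (metis exp_gt_zero exp_ln order_less_le_trans)

text \<open>Both \<open>\<Lambda>\<close> and \<open>L\<close> are at least 1, so comparing such
  monomials reduces to comparing constants and exponents.\<close>

lemma monomial_mono:
  "c \<le> c' \<Longrightarrow> 0 \<le> c \<Longrightarrow> i \<le> i' \<Longrightarrow> j \<le> j' \<Longrightarrow> c * \<Lambda> ^ i * L ^ j \<le> c' * \<Lambda> ^ i' * L ^ j'"
  using \<Lambda> L by (intro mult_mono power_increasing) auto

lemma monomial_ge_one: "1 \<le> \<Lambda> ^ i * L ^ j"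
  using monomial_mono[of 1 1 0 i 0 j] by simp

lemma finite_S: "finite S"
proof (rule finite_subset[OF _ finite_height_le])
  show "S \<subseteq> {q. mult_height q \<le> \<lfloor>H\<rfloor>}" by (auto simp: S_def le_floor_iff)
qed

definition D where "D = 4 * \<Lambda>\<^sup>2 * L"

lemma D_ge: "D \<ge> 4"
  using monomial_mono[of 4 4 0 2 0 1] by (simp add: D_def)

text \<open>The height condition gives \<open>norm (f q) \<le> H\<close>, and the lower growth
  condition then yields \<open>1 / (2 * \<Lambda> * (1 - q)) \<le> L + \<Lambda> \<le> 2 * \<Lambda>
  * L\<close>. This is where \<open>D\<close> comes from.\<close>

lemma S_le:
  assumes "q \<in> S"
  shows "real_of_rat q \<le> 1 - 1 / D"
proof -
  define x where "x = real_of_rat q"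
  have x: "0 < x" "x < 1" using assms by (auto simp: x_def S_def)
  obtain r where r: "f (of_rat q) = of_rat r" "of_int (mult_height r) \<le> H"
    using assms by (auto simp: S_def)
  have "exp (1 / (2 * \<Lambda> * (1 - x))) / \<Lambda> \<le> norm (f (of_real x))" using low x by blast
  also have "\<dots> \<le> H" using norm_of_rat_le_height[of r] r by (simp add: x_def of_real_of_rat)
  finally have "exp (1 / (2 * \<Lambda> * (1 - x))) \<le> H * \<Lambda>" using \<Lambda> by (simp add: divide_simps)
  also have "\<dots> \<le> exp L * exp \<Lambda>"
    unfolding exp_L using le_exp[of \<Lambda>] exp_L[symmetric] by (intro mult_left_mono) auto
  finally have "1 / (2 * \<Lambda> * (1 - x)) \<le> L + \<Lambda>" by (simp flip: exp_add)
  also have "\<dots> \<le> 2 * \<Lambda> * L"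
    using monomial_mono[of 1 1 0 1 1 1] monomial_mono[of 1 1 1 1 0 1] by simp
  finally have "1 \<le> 2 * \<Lambda> * L * (2 * \<Lambda> * (1 - x))" using x \<Lambda> by (simp add: divide_simps)
  also have "\<dots> = D * (1 - x)" by (simp add: D_def power2_eq_square)
  finally show ?thesis using D_ge by (simp add: field_simps x_def)
qed

lemma norm_f_le:
  fixes v :: real
  assumes "v \<ge> 1" "norm z = 1 - 1 / (2 * v)"
  shows "norm (f z) \<le> exp (4 * \<Lambda> * v\<^sup>2)"
proof -
  have "1 / (2 * v) \<le> 1 / 2" "0 < 1 / (2 * v)" using assms(1) by (auto simp: field_simps)
  then have "norm (f z) \<le> exp (\<Lambda> / (1 - norm z)\<^sup>2)"
    using assms(2) by (intro up) linarith+
  also have "\<Lambda> / (1 - norm z)\<^sup>2 = 4 * \<Lambda> * v\<^sup>2"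
    using assms by (simp add: power_divide power_mult_distrib)
  finally show ?thesis .
qed

text \<open>
  The factor \<open>625\<close> is what \<open>parameters_small\<close> needs, and the factor \<open>131072\<close> in \<open>V\<close> below is what
  \<open>f_large\<close> needs.
\<close>

definition T where "T = nat \<lceil>625 * \<Lambda> ^ 7 * L ^ 3\<rceil>"

lemma T_ge: "625 * \<Lambda> ^ 7 * L ^ 3 \<le> real T"
  unfolding T_def by linarith

lemma T_ge_one: "1 \<le> real T"
  using T_ge monomial_ge_one[of 7 3] by linarith

lemma T_le: "real T \<le> 626 * \<Lambda> ^ 7 * L ^ 3"
proof -
  have "0 \<le> 625 * \<Lambda> ^ 7 * L ^ 3" using \<Lambda> L by simp
  then have "real T \<le> 625 * \<Lambda> ^ 7 * L ^ 3 + 1" unfolding T_def by linarith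
  then show ?thesis using monomial_ge_one[of 7 3] by linarith
qed

lemma floor_H_power_le: "real_of_int \<lfloor>H\<rfloor> ^ n \<le> exp (real n * L)"
proof -
  have "H \<ge> 0" using H exp_gt_zero[of 1] by linarith
  then have "real_of_int \<lfloor>H\<rfloor> ^ n \<le> H ^ n" by (intro power_mono) auto
  then show ?thesis by (simp only: exp_mult_power[symmetric] exp_L)
qed

lemma floor_H_ge_one: "\<lfloor>H\<rfloor> \<ge> 1"
  using H exp_ge_add_one_self[of 1] by (simp add: le_floor_iff)

lemma coefficient_bound: "2 * real T ^ 2 * of_int \<lfloor>H\<rfloor> ^ (3 * T) \<le> exp (4 * real T + 3 * real T * L)"
  unfolding exp_add
  using double_square_le_exp[of T] floor_H_power_le[of "3 * T"] floor_H_ge_one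
  by (intro mult_mono) auto

text \<open>In the exponent on the left the dominant term is
  \<open>4 * \<Lambda> * D\<^sup>2 * T\<close>, of order \<open>\<Lambda> ^ 5 * L ^ 2 * T\<close>.
  So \<open>T\<^sup>2 / (2 * D)\<close> wins once \<open>T\<close> is a large enough multiple of
  \<open>\<Lambda> ^ 7 * L ^ 3\<close>.\<close>

lemma parameters_small:
  "(2 * real T ^ 2)\<^sup>2 * of_int \<lfloor>H\<rfloor> ^ (6 * T) * exp (4 * \<Lambda> * D\<^sup>2) ^ T < exp (real T ^ 2 / (2 * D))"
proof -
  define y where "y = \<Lambda> ^ 5 * L ^ 2"
  have y: "1 \<le> y" "L \<le> y"
    using monomial_ge_one[of 5 2] monomial_mono[of 1 1 0 5 1 2] by (auto simp: y_def)
  have "(2 * real T ^ 2)\<^sup>2 \<le> exp (4 * real T) ^ 2"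
    using double_square_le_exp[of T] by (intro power_mono) auto
  then have "(2 * real T ^ 2)\<^sup>2 \<le> exp (8 * real T)" by (simp add: exp_mult_power)
  then have "(2 * real T ^ 2)\<^sup>2 * of_int \<lfloor>H\<rfloor> ^ (6 * T) * exp (4 * \<Lambda> * D\<^sup>2) ^ T
      \<le> exp (8 * real T) * exp (real (6 * T) * L) * exp (real T * (4 * \<Lambda> * D\<^sup>2))"
    using floor_H_power_le[of "6 * T"] floor_H_ge_one
    by (intro mult_mono) (auto simp: exp_mult_power)
  also have "\<dots> = exp (8 * real T + 6 * real T * L + real T * (64 * y))"
    by (simp add: D_def y_def power_mult_distrib algebra_simps flip: exp_add)
       (simp add: eval_nat_numeral)
  also have "\<dots> < exp (real T ^ 2 / (2 * D))"
  proof -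
    have "real T * L \<le> real T * y" "real T * 1 \<le> real T * y"
      using y by (intro mult_left_mono; simp)+
    moreover have "1 \<le> real T * y" using mult_mono[of 1 "real T" 1 y] T_ge_one y by simp
    \<comment> \<open>The left side is at most 78 times \<open>T * y\<close>, and 625 / 8 is just
      above 78 = 8 + 6 + 64.\<close>
    ultimately have "8 * real T + 6 * real T * L + real T * (64 * y) < real T * (625 / 8 * y)"
      by linarith
    also have "real T * (625 / 8 * y) = real T * (625 * \<Lambda> ^ 7 * L ^ 3) / (2 * D)"
      using \<Lambda> L by (simp add: D_def y_def field_simps) (simp add: eval_nat_numeral)
    also have "\<dots> \<le> real T * real T / (2 * D)"
      using T_ge D_ge by (intro divide_right_mono mult_left_mono) auto
    finally show ?thesis by (simp add: power2_eq_square)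
  qed
  finally show ?thesis .
qed

section \<open>Estimates at the evaluation point near the unit circle\<close>

definition V where "V = nat \<lceil>131072 * \<Lambda> ^ 9 * L ^ 4\<rceil>"

text \<open>The window of \<open>2 * T\<close> integers is the one in which
  \<open>bipoly_ge_at_reciprocal\<close> finds its \<open>v\<close>.\<close>

context
  fixes v :: nat
  assumes v: "V \<le> v" "v < V + 2 * T"
begin

lemma v_ge: "131072 * \<Lambda> ^ 9 * L ^ 4 \<le> real v"
  using v(1) unfolding V_def by linarith

lemma v_le: "real v \<le> 140000 * \<Lambda> ^ 9 * L ^ 4"
proof -
  have "0 \<le> 131072 * \<Lambda> ^ 9 * L ^ 4" using \<Lambda> L by simp
  then have "real V \<le> 131072 * \<Lambda> ^ 9 * L ^ 4 + 1" unfolding V_def by linarith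
  moreover have "real v \<le> real V + 2 * real T" using v(2) by linarith
  moreover have "626 * \<Lambda> ^ 7 * L ^ 3 \<le> 626 * \<Lambda> ^ 9 * L ^ 4" by (intro monomial_mono) auto
  \<comment> \<open>The constant has room for 131072 + 1 + 2 * 626.\<close>
  ultimately show ?thesis using T_le monomial_ge_one[of 9 4] by linarith
qed

lemma monomial_le_v: "i \<le> 9 \<Longrightarrow> j \<le> 4 \<Longrightarrow> 4 * \<Lambda> ^ i * L ^ j \<le> real v"
  by (rule order_trans[OF monomial_mono v_ge]) auto

lemma v_ge_one: "1 \<le> real v"
  using monomial_le_v[of 0 0] by simp

lemma v_le_exp: "real v \<le> exp (31 * \<Lambda> * L)"
proof -
  have "(2::real) \<le> exp 1" using exp_ge_add_one_self[of 1] by simp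
  \<comment> \<open>\<open>2 ^ 18\<close> exceeds 140000; together with the powers 9 and 4 this
    gives 31 = 18 + 9 + 4.\<close>
  then have "(2::real) ^ 18 \<le> exp 1 ^ 18" by (intro power_mono) auto
  moreover have "\<Lambda> ^ 9 \<le> exp \<Lambda> ^ 9" "L ^ 4 \<le> exp L ^ 4"
    using \<Lambda> L by (auto intro!: power_mono le_exp)
  ultimately have "140000 * \<Lambda> ^ 9 * L ^ 4 \<le> exp 1 ^ 18 * exp \<Lambda> ^ 9 * exp L ^ 4"
    using \<Lambda> L by (intro mult_mono) auto
  also have "\<dots> = exp (18 + 9 * \<Lambda> + 4 * L)" by (simp add: exp_mult_power exp_add)
  also have "\<dots> \<le> exp (31 * \<Lambda> * L)"
    using monomial_mono[of 18 18 0 1 0 1] monomial_mono[of 9 9 1 1 0 1] monomial_mono[of 4 4 0 1 1 1] by simp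
  finally show ?thesis using v_le by linarith
qed

text \<open>The left side bounds the size that \<open>bipoly_ge_at_reciprocal\<close> demands of
  \<open>w\<close>: \<open>4 * T\<close> comes from \<open>4 * T\<^sup>2\<close>, then
  \<open>4 * T + 3 * T * L\<close> from the coefficients, and \<open>62 * T * \<Lambda> * L\<close>
  from \<open>v ^ (2 * T)\<close> by \<open>v_le_exp\<close>.\<close>

lemma f_large:
  "exp (8 * real T + 3 * real T * L + 62 * real T * \<Lambda> * L) \<le> norm (f (of_real (1 - 1 / real v)))"
proof -
  have "real T * (1 * 1) \<le> real T * (\<Lambda> * L)" "real T * (1 * L) \<le> real T * (\<Lambda> * L)" "1 * (\<Lambda> * 1) \<le> real T * (\<Lambda> * L)"
    using \<Lambda> L T_ge_one by (intro mult_mono; simp)+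
  \<comment> \<open>Here 74 = 8 + 3 + 62 + 1, where the summand \<open>\<Lambda>\<close> pays for
    the division by \<open>\<Lambda> \<le> exp \<Lambda>\<close>. Below, 74 * 626 = 46324 stays
    under 131072 / 2.\<close>
  then have "8 * real T + 3 * real T * L + 62 * real T * \<Lambda> * L + \<Lambda> \<le> 74 * (real T * (\<Lambda> * L))"
    by (simp add: algebra_simps)
  also have "\<dots> \<le> 74 * ((626 * \<Lambda> ^ 7 * L ^ 3) * (\<Lambda> * L))"
    using T_le \<Lambda> L by (intro mult_left_mono mult_right_mono) auto
  also have "\<dots> = 46324 * \<Lambda> ^ 8 * L ^ 4" by (simp add: eval_nat_numeral)
  also have "\<dots> \<le> 65536 * \<Lambda> ^ 8 * L ^ 4" by (intro monomial_mono) auto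
  also have "\<dots> = 131072 * \<Lambda> ^ 9 * L ^ 4 / (2 * \<Lambda>)" using \<Lambda> by (simp add: eval_nat_numeral)
  also have "\<dots> \<le> real v / (2 * \<Lambda>)" using v_ge \<Lambda> by (intro divide_right_mono) auto
  finally have "exp (8 * real T + 3 * real T * L + 62 * real T * \<Lambda> * L) \<le> exp (real v / (2 * \<Lambda>) - \<Lambda>)"
    by simp
  also have "\<dots> = exp (real v / (2 * \<Lambda>)) / exp \<Lambda>" by (rule exp_diff)
  also have "\<dots> \<le> exp (real v / (2 * \<Lambda>)) / \<Lambda>"
    using \<Lambda> le_exp[of \<Lambda>] by (intro divide_left_mono mult_pos_pos) auto
  also have "real v / (2 * \<Lambda>) = 1 / (2 * \<Lambda> * (1 - (1 - 1 / real v)))"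
    using v_ge_one \<Lambda> by simp
  also have "exp \<dots> / \<Lambda> \<le> norm (f (of_real (1 - 1 / real v)))"
    using v_ge_one monomial_le_v[of 0 0] by (intro low) (auto simp: field_simps)
  finally show ?thesis .
qed

text \<open>Taking logarithms, the dominant term is \<open>w\<close>, which comes from the bound of
  \<open>f\<close> on the circle. Hence \<open>card S\<close> is of order
  \<open>\<Lambda> * T * v ^ 3\<close>, with exponents 1 + 7 + 27 = 35 of \<open>\<Lambda>\<close>
  and 3 + 12 = 15 of \<open>L\<close>.\<close>

lemma card_S_le_if_exp_le:
  assumes "exp (real (card S) / (2 * real v))
    \<le> 2 * real v ^ (2 * T) * (real (2 * T) * real T * (2 * real T ^ 2 * of_int \<lfloor>H\<rfloor> ^ (3 * T)) * exp (4 * \<Lambda> * (real v)\<^sup>2) ^ T)"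
  shows "real (card S) \<le> 10 ^ 20 * \<Lambda> ^ 35 * L ^ 18"
proof -
  define w where "w = real T * \<Lambda> * (real v)\<^sup>2"
  have "real v ^ (2 * T) \<le> exp (real v) ^ (2 * T)"
    by (intro power_mono le_exp) auto
  then have vT: "real v ^ (2 * T) \<le> exp (2 * real T * real v)" by (simp add: exp_mult_power)
  have "exp (real (card S) / (2 * real v))
    \<le> 2 * real v ^ (2 * T) * (real (2 * T) * real T * (2 * real T ^ 2 * of_int \<lfloor>H\<rfloor> ^ (3 * T)) * exp (4 * \<Lambda> * (real v)\<^sup>2) ^ T)"
    by (rule assms)
  also have "\<dots> \<le> exp 1 * exp (2 * real T * real v)
      * (exp (4 * real T) * exp (4 * real T + 3 * real T * L) * exp (4 * w))"
    using exp_ge_add_one_self[of 1] vT double_square_le_exp[of T] coefficient_bound floor_H_ge_one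
    by (intro mult_mono) (auto simp: exp_mult_power w_def power2_eq_square algebra_simps)
  also have "\<dots> = exp (1 + 2 * real T * real v + 8 * real T + 3 * real T * L + 4 * w)"
    by (simp flip: exp_add)
  finally have "real (card S) / (2 * real v) \<le> 1 + 2 * real T * real v + 8 * real T + 3 * real T * L + 4 * w"
    by simp
  \<comment> \<open>Each of the five terms is its coefficient times at most \<open>w\<close>, and 18
    = 1 + 2 + 8 + 3 + 4.\<close>
  also have "\<dots> \<le> 18 * w"
  proof -
    have w: "w = real T * (\<Lambda> * (real v * real v))" by (simp add: w_def power2_eq_square)
    have "L \<le> real v" using monomial_le_v[of 0 1] L by simp
    then have "1 * (1 * (1 * 1)) \<le> w" "real T * (1 * (1 * 1)) \<le> w" "real T * (1 * (real v * 1)) \<le> w" "real T * (1 * (L * 1)) \<le> w"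
      unfolding w using \<Lambda> L T_ge_one v_ge_one by (intro mult_mono mult_nonneg_nonneg; simp)+
    then show ?thesis by simp
  qed
  finally have "real (card S) \<le> 36 * (\<Lambda> * real T * real v ^ 3)"
    using v_ge_one by (simp add: w_def field_simps eval_nat_numeral)
  also have "\<dots> \<le> 36 * (\<Lambda> * (626 * \<Lambda> ^ 7 * L ^ 3) * (140000 * \<Lambda> ^ 9 * L ^ 4) ^ 3)"
    using T_le v_le \<Lambda> L by (intro mult_left_mono mult_mono power_mono) auto
  also have "\<dots> = 22536 * 140000 ^ 3 * \<Lambda> ^ 35 * L ^ 15" by algebra
  also have "\<dots> \<le> 10 ^ 20 * \<Lambda> ^ 35 * L ^ 18"
    by (intro monomial_mono) auto
  finally show ?thesis .
qed

end

lemma card_S_le: "real (card S) \<le> 10 ^ 20 * \<Lambda> ^ 35 * L ^ 18"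
proof (cases "T\<^sup>2 \<le> card S")
  \<comment> \<open>With fewer than \<open>T\<^sup>2\<close> points there is nothing to construct:
    the count is already of order \<open>L ^ 6\<close>.\<close>
  case False
  then have "real (card S) \<le> real (T\<^sup>2)" by simp
  also have "\<dots> \<le> (626 * \<Lambda> ^ 7 * L ^ 3)\<^sup>2" using T_le by (simp add: power_mono)
  also have "\<dots> = 391876 * \<Lambda> ^ 14 * L ^ 6" by (simp add: power_mult_distrib flip: power_mult)
  also have "\<dots> \<le> 10 ^ 20 * \<Lambda> ^ 35 * L ^ 18" by (intro monomial_mono) auto
  finally show ?thesis .
next
  case True
  define X where "X = 2 * real T ^ 2 * of_int \<lfloor>H\<rfloor> ^ (3 * T)"
  have T1: "T \<ge> 1" using T_ge_one by simp
  obtain p where p: "\<exists>ij\<in>{..<2 * T} \<times> {..<T}. p ij \<noteq> 0"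
    "\<And>ij. ij \<in> {..<2 * T} \<times> {..<T} \<Longrightarrow> real_of_int \<bar>p ij\<bar> \<le> X"
    "\<And>q. q \<in> S \<Longrightarrow> bipoly (2 * T) T p (of_rat q) (f (of_rat q)) = 0"
    unfolding X_def
  proof (rule vanishing_polynomial[OF f T1 floor_H_ge_one _ True _ _ norm_f_le _ parameters_small])
    show "0 < q \<and> real_of_rat q \<le> 1 - 1 / D \<and> mult_height q \<le> \<lfloor>H\<rfloor>" if "q \<in> S" for q
      using S_le[OF that] that by (auto simp: S_def le_floor_iff)
    show "\<exists>r. f (of_rat q) = of_rat r \<and> mult_height r \<le> \<lfloor>H\<rfloor>" if "q \<in> S" for q
      using that by (auto simp: S_def le_floor_iff)
  qed (use D_ge \<Lambda> in auto)
  have V1: "V \<ge> 1" using monomial_ge_one[of 9 4] unfolding V_def by linarith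
  obtain v where v: "V \<le> v" "v < V + 2 * T"
    and ge: "\<And>w. norm w \<ge> 1 \<Longrightarrow> norm w \<ge> 2 * real (2 * T) * real T * X * real v ^ (2 * T) \<Longrightarrow>
       norm (bipoly (2 * T) T p (of_real (1 - 1 / real v)) w) \<ge> 1 / (2 * real v ^ (2 * T))"
    using bipoly_ge_at_reciprocal[OF p(1,2) V1] by blast
  note v1 = v_ge_one[OF v]
  have X0: "X \<ge> 0" using floor_H_ge_one by (simp add: X_def)
  let ?w = "f (of_real (1 - 1 / real v))"
  have "2 * real (2 * T) * real T * X * real v ^ (2 * T) = 4 * real T ^ 2 * X * real v ^ (2 * T)"
    by (simp add: power2_eq_square)
  also have "\<dots> \<le> exp (4 * real T) * exp (4 * real T + 3 * real T * L) * exp (31 * \<Lambda> * L) ^ (2 * T)"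
    using four_square_le_exp[of T] coefficient_bound v_le_exp[OF v] X0
    by (intro mult_mono power_mono) (auto simp: X_def)
  also have "\<dots> = exp (8 * real T + 3 * real T * L + 62 * real T * \<Lambda> * L)"
    by (simp add: exp_mult_power flip: exp_add)
  also have "\<dots> \<le> norm ?w" by (rule f_large[OF v])
  finally have "2 * real (2 * T) * real T * X * real v ^ (2 * T) \<le> norm ?w" .
  moreover have "1 \<le> norm ?w"
    using \<Lambda> L by (intro order_trans[OF _ f_large[OF v]]) simp
  ultimately have "norm (bipoly (2 * T) T p (of_real (1 - 1 / real v)) ?w) \<ge> 1 / (2 * real v ^ (2 * T))"
    by (intro ge)
  then have "exp (real (card (real_of_rat ` S)) / (2 * real v))
    \<le> 2 * real v ^ (2 * T) * (real (2 * T) * real T * X * exp (4 * \<Lambda> * (real v)\<^sup>2) ^ T)"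
  proof (rule zero_count[OF f _ p(2) X0 norm_f_le, rotated -1])
    \<comment> \<open>All counted points lie to the left of the evaluation point, as
      \<open>zero_count\<close> requires.\<close>
    have "D \<le> real v" using monomial_le_v[OF v, of 2 1] by (simp add: D_def)
    then have "1 - 1 / D \<le> 1 - 1 / real v" using D_ge by (simp add: frac_le)
    then show "real_of_rat ` S \<subseteq> {0..1 - 1 / real v}"
      using S_le by (fastforce simp: S_def)
    show "bipoly (2 * T) T p (of_real z) (f (of_real z)) = 0" if "z \<in> real_of_rat ` S" for z
      using that p(3) by (auto simp: of_real_of_rat)
  qed (use v1 \<Lambda> finite_S in auto)
  moreover have "card (real_of_rat ` S) = card S" by (simp add: card_image inj_on_def)
  ultimately show ?thesis by (intro card_S_le_if_exp_le[OF v]) (simp add: X_def)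
qed

end

section \<open>Computability of the constant\<close>

text \<open>Total functionals of fixed arity. The closure lemmas need only primitive recursion and
  oracle queries; unbounded search enters in \<open>computable_by_enclosures\<close> alone.\<close>

definition programmable :: "nat \<Rightarrow> ((nat \<Rightarrow> nat \<Rightarrow> nat) \<Rightarrow> nat list \<Rightarrow> nat) \<Rightarrow> bool" where
  "programmable n F \<longleftrightarrow> (\<exists>P. \<forall>A xs. length xs = n \<longrightarrow> run P A xs = Some (F A xs))"

lemma programmable_arg: "i < n \<Longrightarrow> programmable n (\<lambda>A xs. xs ! i)"
  unfolding programmable_def by (rule exI[of _ "Arg i"]) simp

lemma programmable_compose:
  assumes F: "programmable (length gs) F" and gs: "\<And>g. g \<in> set gs \<Longrightarrow> programmable n g"
  shows "programmable n (\<lambda>A xs. F A (map (\<lambda>g. g A xs) gs))"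
proof -
  obtain P where P: "\<And>A xs. length xs = length gs \<Longrightarrow> run P A xs = Some (F A xs)"
    using F unfolding programmable_def by blast
  have "\<forall>g\<in>set gs. \<exists>Q. \<forall>A xs. length xs = n \<longrightarrow> run Q A xs = Some (g A xs)"
    using gs unfolding programmable_def by blast
  then obtain Q where Q: "\<forall>g\<in>set gs. \<forall>A xs. length xs = n \<longrightarrow> run (Q g) A xs = Some (g A xs)"
    unfolding bchoice_iff by blast
  have "run (Compose P (map Q gs)) A xs = Some (F A (map (\<lambda>g. g A xs) gs))" if "length xs = n" for A xs
  proof -
    have "those (map (\<lambda>g. run g A xs) (map Q gs)) = Some (map (\<lambda>g. g A xs) gs)"
      using Q that by (induction gs) auto
    then show ?thesis by (simp only: run.simps) (simp add: P)
  qed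
  then show ?thesis unfolding programmable_def by blast
qed

lemma programmable_compose1:
  assumes "programmable 1 F" "programmable n g"
  shows "programmable n (\<lambda>A xs. F A [g A xs])"
  using programmable_compose[of "[g]" F n] assms by simp

lemma programmable_compose2:
  assumes "programmable 2 F" "programmable n g" "programmable n h"
  shows "programmable n (\<lambda>A xs. F A [g A xs, h A xs])"
  using programmable_compose[of "[g, h]" F n] assms by (auto simp: numeral_2_eq_2)

lemma programmable_Suc: "programmable n g \<Longrightarrow> programmable n (\<lambda>A xs. Suc (g A xs))"
proof (rule programmable_compose1[where F = "\<lambda>A xs. Suc (xs ! 0)", simplified])
  show "programmable (Suc 0) (\<lambda>A xs. Suc (xs ! 0))"
    unfolding programmable_def by (rule exI[of _ Succ]) (auto simp: length_Suc_conv)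
qed

lemma programmable_query: "programmable n g \<Longrightarrow> programmable n (\<lambda>A xs. A i (g A xs))"
proof (rule programmable_compose1[where F = "\<lambda>A xs. A i (xs ! 0)", simplified])
  show "programmable (Suc 0) (\<lambda>A xs. A i (xs ! 0))"
    unfolding programmable_def by (rule exI[of _ "Query i"]) (auto simp: length_Suc_conv)
qed

lemma programmable_const: "programmable n (\<lambda>A xs. c)"
proof (induction c)
  case 0
  show ?case unfolding programmable_def by (rule exI[of _ Zero]) simp
next
  case (Suc c)
  then show ?case by (rule programmable_Suc)
qed

lemma programmable_rec:
  assumes f: "programmable n f" and g: "programmable (Suc (Suc n)) g"
  shows "programmable (Suc n) (\<lambda>A xs. rec_nat (f A (tl xs)) (\<lambda>m r. g A (m # r # tl xs)) (xs ! 0))"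
proof -
  obtain P Q where P: "\<And>A xs. length xs = n \<Longrightarrow> run P A xs = Some (f A xs)"
    and Q: "\<And>A xs. length xs = Suc (Suc n) \<Longrightarrow> run Q A xs = Some (g A xs)"
    using f g unfolding programmable_def by blast
  have "rec_nat (run P A ys) (\<lambda>m r. Option.bind r (\<lambda>y. run Q A (m # y # ys))) k
      = Some (rec_nat (f A ys) (\<lambda>m r. g A (m # r # ys)) k)" if "length ys = n" for A ys k
    using that by (induction k) (simp_all add: P Q)
  then have "\<forall>A xs. length xs = Suc n \<longrightarrow> run (PrimRec P Q) A xs =
      Some (rec_nat (f A (tl xs)) (\<lambda>m r. g A (m # r # tl xs)) (xs ! 0))"
    by (auto simp: length_Suc_conv)
  then show ?thesis unfolding programmable_def by blast
qed

text \<open>Composition with \<open>u\<close> and \<open>v\<close> is built in, so that each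
  arithmetic operation below only has to supply its recursion equation in the first argument of
  \<open>h\<close>.\<close>

lemma programmable_rec2:
  assumes f: "programmable 1 (\<lambda>A xs. f (xs ! 0))" and g: "programmable 3 (\<lambda>A xs. g (xs ! 0) (xs ! 1) (xs ! 2))"
    and h: "\<And>x y. h x y = rec_nat (f y) (\<lambda>m r. g m r y) x" and "programmable n u" "programmable n v"
  shows "programmable n (\<lambda>A xs. h (u A xs) (v A xs))"
proof -
  have "programmable 2 (\<lambda>A xs. rec_nat (f (tl xs ! 0)) (\<lambda>m r. g ((m # r # tl xs) ! 0) ((m # r # tl xs) ! 1) ((m # r # tl xs) ! 2)) (xs ! 0))"
    using programmable_rec[of 1 "\<lambda>A xs. f (xs ! 0)" "\<lambda>A xs. g (xs ! 0) (xs ! 1) (xs ! 2)"] f g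
    by (simp add: numeral_2_eq_2 numeral_3_eq_3)
  from programmable_compose2[OF this assms(4,5)] show ?thesis
    by (simp add: h)
qed

lemma programmable_add:
  "programmable n u \<Longrightarrow> programmable n v \<Longrightarrow> programmable n (\<lambda>A xs. u A xs + v A xs)"
proof (rule programmable_rec2[where h = "(+)" and f = "\<lambda>y. y" and g = "\<lambda>m r y. Suc r"])
  show "x + y = rec_nat y (\<lambda>m r. Suc r) x" for x y by (induction x) auto
qed (auto intro!: programmable_Suc programmable_arg)

lemma programmable_mult:
  "programmable n u \<Longrightarrow> programmable n v \<Longrightarrow> programmable n (\<lambda>A xs. u A xs * v A xs)"
proof (rule programmable_rec2[where h = "(*)" and f = "\<lambda>y. 0" and g = "\<lambda>m r y. y + r"])
  show "x * y = rec_nat 0 (\<lambda>m r. y + r) x" for x y by (induction x) auto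
qed (auto intro!: programmable_add programmable_const programmable_arg)

lemma programmable_pred: "programmable n u \<Longrightarrow> programmable n (\<lambda>A xs. u A xs - 1)"
proof (rule programmable_rec2[where h = "\<lambda>x y. x - 1" and f = "\<lambda>y. 0" and g = "\<lambda>m r y. m"])
  show "x - 1 = rec_nat 0 (\<lambda>m r. m) x" for x :: nat by (induction x) auto
qed (auto intro!: programmable_const programmable_arg)

lemma programmable_diff:
  "programmable n u \<Longrightarrow> programmable n v \<Longrightarrow> programmable n (\<lambda>A xs. u A xs - v A xs)"
\<comment> \<open>The recursion runs over the subtrahend, hence the swapped arguments.\<close>
proof (rule programmable_rec2[where h = "\<lambda>x y. y - x" and f = "\<lambda>y. y" and g = "\<lambda>m r y. r - 1"])
  show "y - x = rec_nat y (\<lambda>m r. r - 1) x" for x y :: nat by (induction x) auto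
  show "programmable 3 (\<lambda>A xs. xs ! 1 - 1)" by (intro programmable_pred programmable_arg) simp
qed (auto intro!: programmable_arg)

lemma programmable_power:
  "programmable n u \<Longrightarrow> programmable n v \<Longrightarrow> programmable n (\<lambda>A xs. u A xs ^ v A xs)"
proof (rule programmable_rec2[where h = "\<lambda>x y. y ^ x" and f = "\<lambda>y. 1" and g = "\<lambda>m r y. y * r"])
  show "y ^ x = rec_nat 1 (\<lambda>m r. y * r) x" for x y :: nat by (induction x) auto
  show "programmable 3 (\<lambda>A xs. xs ! 2 * xs ! 1)" by (intro programmable_mult programmable_arg) simp_all
qed (auto intro!: programmable_const)

lemma programmable_min:
  "programmable n u \<Longrightarrow> programmable n v \<Longrightarrow> programmable n (\<lambda>A xs. min (u A xs) (v A xs))"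
proof -
  have "min x y = x - (x - y)" for x y :: nat by simp
  then show "programmable n u \<Longrightarrow> programmable n v \<Longrightarrow> programmable n (\<lambda>A xs. min (u A xs) (v A xs))"
    by (simp only:) (intro programmable_diff)
qed

text \<open>
  The recursion counts the multiples of the divisor up to \<open>x\<close>; for divisor \<open>0\<close> it would not give
  the junk value \<open>x div 0 = 0\<close>, hence the successor.
\<close>

lemma programmable_div_Suc:
  "programmable n u \<Longrightarrow> programmable n v \<Longrightarrow> programmable n (\<lambda>A xs. u A xs div Suc (v A xs))"
proof (rule programmable_rec2[where h = "\<lambda>x y. x div Suc y" and f = "\<lambda>y. 0"
      and g = "\<lambda>m r y. r + (1 - (Suc y * Suc r - Suc m))"])
  \<comment> \<open>The summand \<open>1 - (Suc y * Suc r - Suc m)\<close> is 1 if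
    \<open>Suc m\<close> has reached the next multiple of \<open>Suc y\<close>, and 0 otherwise, by
    truncated subtraction.\<close>
  show "x div Suc y = rec_nat 0 (\<lambda>m r. r + (1 - (Suc y * Suc r - Suc m))) x" for x y :: nat
  proof (induction x)
    case (Suc x)
    have "Suc x div Suc y = x div Suc y + (1 - (Suc y * Suc (x div Suc y) - Suc x))"
    proof (cases "Suc y * Suc (x div Suc y) \<le> Suc x")
      case True
      have "x < Suc y * Suc (x div Suc y)"
        by (metis dividend_less_times_div mult_Suc_right zero_less_Suc)
      with True have "Suc x = Suc (x div Suc y) * Suc y" by (simp add: mult.commute)
      then have "Suc x div Suc y = Suc (x div Suc y)" by (metis nat.distinct(1) nonzero_mult_div_cancel_right)
      with True show ?thesis by simp
    next
      case False
      then have "Suc x div Suc y < Suc (x div Suc y)"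
        by (simp only: less_mult_imp_div_less not_le mult.commute)
      moreover have "x div Suc y \<le> Suc x div Suc y" by (intro div_le_mono) simp
      ultimately show ?thesis using False by (simp only: not_le)
    qed
    with Suc show ?case by simp
  qed simp
  show "programmable 3 (\<lambda>A xs. xs ! 1 + (1 - (Suc (xs ! 2) * Suc (xs ! 1) - Suc (xs ! 0))))"
    by (intro programmable_add programmable_diff programmable_mult programmable_Suc programmable_const programmable_arg) simp_all
qed (intro programmable_const)

lemmas programmable_intros =
  programmable_add programmable_diff programmable_mult programmable_power programmable_min
  programmable_div_Suc programmable_query programmable_const programmable_arg

text \<open>
  Searching for a precision \<open>n\<close> at which the enclosure \<open>[l, u]\<close> of \<open>2 ^ k * F xs\<close> has length at
  most \<open>2\<close>, and returning \<open>l + 1\<close>, needs no modulus of continuity: the search only has to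
  succeed eventually.
\<close>

lemma computable_by_enclosures:
  assumes l: "programmable 2 l" and u: "programmable 2 u" and t: "programmable 2 t"
    and encl: "\<And>xs A n k. xs \<in> D \<Longrightarrow> \<forall>i<length xs. dyadic_name (A i) (xs ! i) \<Longrightarrow> t A [n, k] = 0 \<Longrightarrow>
        real (l A [n, k]) \<le> 2 ^ k * F xs \<and> 2 ^ k * F xs \<le> real (u A [n, k])"
    and tight: "\<And>xs A k. xs \<in> D \<Longrightarrow> \<forall>i<length xs. dyadic_name (A i) (xs ! i) \<Longrightarrow>
        \<exists>n. t A [n, k] = 0 \<and> u A [n, k] \<le> l A [n, k] + 2"
  shows "computable_real_on D F"
proof -
  \<comment> \<open>The sum is zero exactly when the enclosure is certified by \<open>t\<close> and
    short enough; \<open>Minimize\<close> searches for such a precision.\<close>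
  have "programmable 2 (\<lambda>A xs. t A xs + (u A xs - (l A xs + 2)))"
    by (intro programmable_intros l u t)
  then obtain P where P: "\<And>A xs. length xs = 2 \<Longrightarrow> run P A xs = Some (t A xs + (u A xs - (l A xs + 2)))"
    unfolding programmable_def by blast
  have "programmable 2 (\<lambda>A xs. l A xs + 1)"
    by (intro programmable_intros l)
  then obtain Q where Q: "\<And>A xs. length xs = 2 \<Longrightarrow> run Q A xs = Some (l A xs + 1)"
    unfolding programmable_def by blast
  show ?thesis
    unfolding computable_real_on_def
  proof (intro exI[of _ "Compose Q [Minimize P, Arg 0]"] ballI allI impI)
    fix xs A assume xs: "xs \<in> D" and A: "\<forall>i<length xs. dyadic_name (A i) (xs ! i)"
    define good where "good = (\<lambda>k n. t A [n, k] + (u A [n, k] - (l A [n, k] + 2)) = 0)"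
    define N where "N = (\<lambda>k. LEAST n. good k n)"
    have ex: "\<exists>n. good k n" for k
      using tight[OF xs A] by (auto simp: good_def)
    have N: "good k (N k)" for k
      unfolding N_def using ex by (rule LeastI_ex)
    have "run (Minimize P) A [k] = Some (N k)" for k
      using ex by (simp add: P N_def good_def)
    then have "run (Compose Q [Minimize P, Arg 0]) A [k] = Some (l A [N k, k] + 1)" for k
      by (simp add: Q)
    moreover have "dyadic_name (\<lambda>k. l A [N k, k] + 1) (F xs)"
      unfolding dyadic_name_def
    proof
      fix k
      have "real (l A [N k, k]) \<le> 2 ^ k * F xs" "2 ^ k * F xs \<le> real (l A [N k, k]) + 2"
        using encl[OF xs A, of "N k" k] N[of k] by (auto simp: good_def)
      then have "\<bar>real (l A [N k, k] + 1) - 2 ^ k * F xs\<bar> \<le> 1" by simp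
      moreover have "real (l A [N k, k] + 1) / 2 ^ k - F xs = (real (l A [N k, k] + 1) - 2 ^ k * F xs) / 2 ^ k"
        by (simp add: diff_divide_distrib)
      ultimately show "\<bar>real (l A [N k, k] + 1) / 2 ^ k - F xs\<bar> \<le> 1 / 2 ^ k"
        by (simp add: abs_divide divide_right_mono)
    qed
    ultimately show "\<exists>p. (\<forall>k. run (Compose Q [Minimize P, Arg 0]) A [k] = Some (p k)) \<and> dyadic_name p (F xs)"
      by (intro exI[of _ "\<lambda>k. l A [N k, k] + 1"] conjI allI)
  qed
qed

section \<open>Interval enclosures of the constant\<close>

lemma real_monus: "real (x - y) = max 0 (real x - real y)"
  by linarith

lemma tendsto_scaled_approximation:
  assumes "\<And>n. \<bar>real (x n) - 2 ^ n * c\<bar> \<le> 2"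
  shows "(\<lambda>n. real (x n) / 2 ^ n) \<longlonglongrightarrow> c"
proof (rule LIM_zero_cancel)
  show "(\<lambda>n. real (x n) / 2 ^ n - c) \<longlonglongrightarrow> 0"
  proof (rule Lim_null_comparison)
    show "\<forall>\<^sub>F n in sequentially. norm (real (x n) / 2 ^ n - c) \<le> 2 * (1 / 2) ^ n"
    proof (intro always_eventually allI)
      fix n
      have "real (x n) / 2 ^ n - c = (real (x n) - 2 ^ n * c) / 2 ^ n" by (simp add: diff_divide_distrib)
      then show "norm (real (x n) / 2 ^ n - c) \<le> 2 * (1 / 2) ^ n"
        using assms[of n] by (simp add: abs_divide power_divide divide_right_mono)
    qed
    show "(\<lambda>n. 2 * (1 / 2) ^ n :: real) \<longlonglongrightarrow> 0"
      by (intro tendsto_mult_right_zero LIMSEQ_power_zero) simp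
  qed
qed

text \<open>Only arithmetic and minima occur, so no logarithm of \<open>b\<close> has to be
  computed.\<close>

definition growth_scale :: "real list \<Rightarrow> real" where
  "growth_scale xs = (1 + xs ! 2) / min (xs ! 0) (min (xs ! 1 - 1) 1)"

text \<open>Interval arithmetic on numerators at precision \<open>n\<close>: names are off by at
  most 1, so shifting by 1 encloses numerator and denominator scaled by \<open>2 ^ n\<close>. The
  scale cancels in the quotient, and both ends converge to the value.\<close>

lemma computable_growth_scale_power:
  "computable_real_on {[a, b, c0] | a b c0. a > 0 \<and> b > 1 \<and> c0 > 0} (\<lambda>xs. real N * growth_scale xs ^ j)"
proof -
  define den_lo where "den_lo = (\<lambda>(A :: nat \<Rightarrow> nat \<Rightarrow> nat) xs.
    min (A 0 (xs ! 0) - 1) (min (A 1 (xs ! 0) - 1 - 2 ^ (xs ! 0)) (2 ^ (xs ! 0))))"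
  define den_hi where "den_hi = (\<lambda>(A :: nat \<Rightarrow> nat \<Rightarrow> nat) xs.
    min (A 0 (xs ! 0) + 1) (min (A 1 (xs ! 0) + 1 - 2 ^ (xs ! 0)) (2 ^ (xs ! 0))))"
  define num_lo where "num_lo = (\<lambda>(A :: nat \<Rightarrow> nat \<Rightarrow> nat) xs. 2 ^ (xs ! 0) + (A 2 (xs ! 0) - 1))"
  define num_hi where "num_hi = (\<lambda>(A :: nat \<Rightarrow> nat \<Rightarrow> nat) xs. 2 ^ (xs ! 0) + A 2 (xs ! 0) + 1)"
  \<comment> \<open>\<open>Suc (d - 1)\<close> is \<open>d\<close> for positive \<open>d\<close>,
    which fits \<open>programmable_div_Suc\<close>. For \<open>u\<close> this needs
    \<open>den_lo\<close> positive, which is what the test \<open>1 - den_lo\<close> certifies; the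
    added 1 in \<open>u\<close> compensates rounding down.\<close>
  define l where "l = (\<lambda>A xs. (2 ^ (xs ! 1) * N * num_lo A xs ^ j) div Suc (den_hi A xs ^ j - 1))"
  define u where "u = (\<lambda>A xs. (2 ^ (xs ! 1) * N * num_hi A xs ^ j) div Suc (den_lo A xs ^ j - 1) + 1)"
  note prog_defs = l_def u_def den_lo_def den_hi_def num_lo_def num_hi_def
  show ?thesis
  proof (rule computable_by_enclosures[of l u "\<lambda>A xs. 1 - den_lo A xs"])
    show "programmable 2 l" "programmable 2 u" "programmable 2 (\<lambda>A xs. 1 - den_lo A xs)"
      unfolding prog_defs by (intro programmable_intros; simp)+
  next
    fix xs :: "real list" and A :: "nat \<Rightarrow> nat \<Rightarrow> nat"
    assume xs: "xs \<in> {[a, b, c0] | a b c0. a > 0 \<and> b > 1 \<and> c0 > 0}"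
      and A: "\<forall>i<length xs. dyadic_name (A i) (xs ! i)"
    obtain a b c where abc: "xs = [a, b, c]" "a > 0" "b > 1" "c > 0" using xs by auto
    define m where "m = min a (min (b - 1) 1)"
    have m: "m > 0" using abc by (simp add: m_def)
    have F: "growth_scale xs = (1 + c) / m" by (simp add: growth_scale_def abc m_def)
    have near: "\<bar>real (A i n) - 2 ^ n * xs ! i\<bar> \<le> 1" if "i < 3" for i n
    proof -
      have "\<bar>real (A i n) / 2 ^ n - xs ! i\<bar> \<le> 1 / 2 ^ n"
        using A that abc by (simp add: dyadic_name_def)
      then have "\<bar>real (A i n) / 2 ^ n - xs ! i\<bar> * 2 ^ n \<le> 1" by (simp add: field_simps)
      then have "\<bar>(real (A i n) / 2 ^ n - xs ! i) * 2 ^ n\<bar> \<le> 1" by (simp add: abs_mult)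
      then show ?thesis by (simp add: algebra_simps)
    qed
    have a: "\<bar>real (A 0 n) - 2 ^ n * a\<bar> \<le> 1" and b: "\<bar>real (A 1 n) - 2 ^ n * b\<bar> \<le> 1"
      and c: "\<bar>real (A 2 n) - 2 ^ n * c\<bar> \<le> 1" for n
      using near[of 0 n] near[of 1 n] near[of 2 n] by (auto simp: abc)
    have pos: "2 ^ n * a > 0" "2 ^ n * (b - 1) > 0" "2 ^ n * c > 0" for n using abc by auto
    have mn: "2 ^ n * m = min (2 ^ n * a) (min (2 ^ n * (b - 1)) (2 ^ n))" for n
      by (simp add: m_def min_mult_distrib_left)
    have b1: "2 ^ n * b = 2 ^ n * (b - 1) + 2 ^ n" for n by (simp add: algebra_simps)
    have den_lo: "real (den_lo A [n, k]) \<le> 2 ^ n * m \<and> 2 ^ n * m \<le> real (den_lo A [n, k]) + 2" for n k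
    proof -
      \<comment> \<open>Truncation at 0 keeps this a lower bound because the exact value is
        positive.\<close>
      have "real (A 0 n - 1) \<le> 2 ^ n * a \<and> 2 ^ n * a \<le> real (A 0 n - 1) + 2"
        using a[of n] pos(1)[of n] by linarith
      moreover have "real (A 1 n - 1 - 2 ^ n) \<le> 2 ^ n * (b - 1) \<and> 2 ^ n * (b - 1) \<le> real (A 1 n - 1 - 2 ^ n) + 2"
        using b[of n] pos(2)[of n] b1[of n] by (simp add: real_monus) linarith
      ultimately show ?thesis
        by (simp only: den_lo_def mn of_nat_min nth_Cons_0 of_nat_power of_nat_numeral) linarith
    qed
    have den_hi: "2 ^ n * m \<le> real (den_hi A [n, k]) \<and> real (den_hi A [n, k]) \<le> 2 ^ n * m + 2" for n k
    proof -
      have "2 ^ n * a \<le> real (A 0 n + 1) \<and> real (A 0 n + 1) \<le> 2 ^ n * a + 2"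
        using a[of n] by linarith
      moreover have "2 ^ n * (b - 1) \<le> real (A 1 n + 1 - 2 ^ n) \<and> real (A 1 n + 1 - 2 ^ n) \<le> 2 ^ n * (b - 1) + 2"
        using b[of n] pos(2)[of n] b1[of n] by (simp add: real_monus) linarith
      ultimately show ?thesis
        by (simp only: den_hi_def mn of_nat_min nth_Cons_0 of_nat_power of_nat_numeral) linarith
    qed
    have num_lo: "real (num_lo A [n, k]) \<le> 2 ^ n * (1 + c) \<and> 2 ^ n * (1 + c) \<le> real (num_lo A [n, k]) + 2" for n k
      using c[of n] pos(3)[of n] by (simp add: num_lo_def real_monus distrib_left) linarith
    have num_hi: "2 ^ n * (1 + c) \<le> real (num_hi A [n, k]) \<and> real (num_hi A [n, k]) \<le> 2 ^ n * (1 + c) + 2" for n k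
      using c[of n] by (simp add: num_hi_def distrib_left) linarith
    define lo where "lo = (\<lambda>n k. 2 ^ k * real N * (real (num_lo A [n, k]) / real (den_hi A [n, k])) ^ j)"
    define up where "up = (\<lambda>n k. 2 ^ k * real N * (real (num_hi A [n, k]) / real (den_lo A [n, k])) ^ j)"
    have hi_pos: "den_hi A [n, k] > 0" for n k
    proof -
      have "0 < 2 ^ n * m" using m by simp
      then have "0 < real (den_hi A [n, k])" using den_hi[of n k] by linarith
      then show ?thesis by simp
    qed
    have l_floor: "real (l A [n, k]) = real_of_int \<lfloor>lo n k\<rfloor>" for n k
    proof -
      have "l A [n, k] = (2 ^ k * N * num_lo A [n, k] ^ j) div den_hi A [n, k] ^ j"
        using hi_pos[of n k] by (simp add: l_def)
      then show ?thesis
        using floor_divide_of_nat_eq[of "2 ^ k * N * num_lo A [n, k] ^ j" "den_hi A [n, k] ^ j", where ?'a = real]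
        by (simp add: lo_def power_divide)
    qed
    have u_floor: "real (u A [n, k]) = real_of_int \<lfloor>up n k\<rfloor> + 1" if "den_lo A [n, k] > 0" for n k
    proof -
      have "u A [n, k] = (2 ^ k * N * num_hi A [n, k] ^ j) div den_lo A [n, k] ^ j + 1"
        using that by (simp add: u_def)
      then show ?thesis
        using floor_divide_of_nat_eq[of "2 ^ k * N * num_hi A [n, k] ^ j" "den_lo A [n, k] ^ j", where ?'a = real]
        by (simp add: up_def power_divide)
    qed
    show "real (l A [n, k]) \<le> 2 ^ k * (real N * growth_scale xs ^ j) \<and>
        2 ^ k * (real N * growth_scale xs ^ j) \<le> real (u A [n, k])" if t: "1 - den_lo A [n, k] = 0" for n k
    proof
      have F': "growth_scale xs = (2 ^ n * (1 + c)) / (2 ^ n * m)" by (simp add: F)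
      have nm: "0 < 2 ^ n * m" using m by simp
      have "real (num_lo A [n, k]) / real (den_hi A [n, k]) \<le> growth_scale xs"
        unfolding F' using num_lo[of n k] den_hi[of n k] nm by (intro frac_le) auto
      then have "lo n k \<le> 2 ^ k * (real N * growth_scale xs ^ j)"
        by (simp add: lo_def mult.assoc mult_left_mono power_mono)
      then show "real (l A [n, k]) \<le> 2 ^ k * (real N * growth_scale xs ^ j)"
        unfolding l_floor by linarith
      have lo_pos: "den_lo A [n, k] > 0" using t by simp
      have "growth_scale xs \<le> real (num_hi A [n, k]) / real (den_lo A [n, k])"
        unfolding F' using num_hi[of n k] den_lo[of n k] lo_pos by (intro frac_le) auto
      moreover have "0 \<le> growth_scale xs" unfolding F using abc(4) m by simp
      ultimately have "2 ^ k * (real N * growth_scale xs ^ j) \<le> up n k"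
        by (simp add: up_def mult.assoc mult_left_mono power_mono)
      then show "2 ^ k * (real N * growth_scale xs ^ j) \<le> real (u A [n, k])"
        unfolding u_floor[OF lo_pos] by linarith
    qed
    show "\<exists>n. 1 - den_lo A [n, k] = 0 \<and> u A [n, k] \<le> l A [n, k] + 2" for k
    proof -
      have lim: "(\<lambda>n. real (num_lo A [n, k]) / 2 ^ n) \<longlonglongrightarrow> 1 + c" "(\<lambda>n. real (num_hi A [n, k]) / 2 ^ n) \<longlonglongrightarrow> 1 + c"
        "(\<lambda>n. real (den_lo A [n, k]) / 2 ^ n) \<longlonglongrightarrow> m" "(\<lambda>n. real (den_hi A [n, k]) / 2 ^ n) \<longlonglongrightarrow> m"
        by (rule tendsto_scaled_approximation; use num_lo[of _ k] num_hi[of _ k] den_lo[of _ k] den_hi[of _ k] in \<open>auto simp: abs_le_iff algebra_simps\<close>)+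
      have "(\<lambda>n. 2 ^ k * real N * ((real (num_hi A [n, k]) / 2 ^ n) / (real (den_lo A [n, k]) / 2 ^ n)) ^ j
          - 2 ^ k * real N * ((real (num_lo A [n, k]) / 2 ^ n) / (real (den_hi A [n, k]) / 2 ^ n)) ^ j)
          \<longlonglongrightarrow> 2 ^ k * real N * ((1 + c) / m) ^ j - 2 ^ k * real N * ((1 + c) / m) ^ j"
        using m by (intro tendsto_intros lim) auto
      then have "(\<lambda>n. up n k - lo n k) \<longlonglongrightarrow> 0" by (simp add: up_def lo_def)
      then have "\<forall>\<^sub>F n in sequentially. up n k - lo n k < 1" by (rule order_tendstoD) simp
      moreover have "\<forall>\<^sub>F n in sequentially. 0 < real (den_lo A [n, k]) / 2 ^ n"
        using lim(3) m by (rule order_tendstoD)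
      ultimately have "\<forall>\<^sub>F n in sequentially. up n k - lo n k < 1 \<and> 0 < real (den_lo A [n, k]) / 2 ^ n"
        by (rule eventually_conj)
      then obtain n where n: "up n k - lo n k < 1" "0 < real (den_lo A [n, k]) / 2 ^ n"
        by (auto simp: eventually_sequentially)
      then have pos: "den_lo A [n, k] > 0" by (simp add: zero_less_divide_iff)
      \<comment> \<open>Rounding costs 1 here and \<open>u\<close> adds another 1, which is the
        tolerance 2 of \<open>computable_by_enclosures\<close>.\<close>
      have "\<lfloor>up n k\<rfloor> \<le> \<lfloor>lo n k\<rfloor> + 1" using n(1) by linarith
      then have "real_of_int \<lfloor>up n k\<rfloor> + 1 \<le> real_of_int \<lfloor>lo n k\<rfloor> + 2" by linarith
      then have "real (u A [n, k]) \<le> real (l A [n, k] + 2)"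
        using u_floor[OF pos] l_floor[of n k] by simp
      then show ?thesis using pos by (intro exI[of _ n]) (simp only: of_nat_le_iff, simp)
    qed
  qed
qed

section \<open>The counting theorem\<close>

text \<open>For the logarithm, \<open>ln b \<ge> 1 - 1 / b\<close> and
  \<open>b \<ge> 1 + 1 / \<Lambda>\<close> give \<open>ln b \<ge> 1 / (\<Lambda> + 1)\<close>, and
  \<open>\<Lambda> + 1 \<le> 2 * \<Lambda>\<close> explains the factor 2.\<close>

lemma growth_scale_bounds:
  assumes "a > 0" "b > 1" "c0 > 0"
  defines "\<Lambda> \<equiv> growth_scale [a, b, c0]"
  shows "1 \<le> \<Lambda>" "c0 \<le> \<Lambda>" "1 / \<Lambda> \<le> a" "1 / (2 * \<Lambda>) \<le> ln b"
proof -
  define m where "m = min a (min (b - 1) 1)"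
  have m: "0 < m" "m \<le> a" "m \<le> b - 1" "m \<le> 1" using assms by (auto simp: m_def)
  have \<Lambda>: "\<Lambda> = (1 + c0) / m" by (simp add: \<Lambda>_def growth_scale_def m_def)
  have "(1 + c0) / 1 \<le> \<Lambda>" unfolding \<Lambda> using m assms by (intro divide_left_mono) auto
  then show \<Lambda>1: "1 \<le> \<Lambda>" "c0 \<le> \<Lambda>" using assms by auto
  have "1 / \<Lambda> = m / (1 + c0)" by (simp add: \<Lambda>)
  also have "\<dots> \<le> m / 1" using m assms by (intro divide_left_mono) auto
  finally have inv: "1 / \<Lambda> \<le> m" by simp
  then show "1 / \<Lambda> \<le> a" using m by simp
  have "1 / (2 * \<Lambda>) \<le> 1 - 1 / (1 + 1 / \<Lambda>)" using \<Lambda>1 by (simp add: field_simps)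
  also have "\<dots> \<le> 1 - 1 / b"
    using inv m \<Lambda>1 assms by (intro diff_left_mono divide_left_mono mult_pos_pos add_pos_pos) auto
  also have "\<dots> \<le> ln b" using ln_le_minus_one[of "1 / b"] assms by (simp add: ln_div)
  finally show "1 / (2 * \<Lambda>) \<le> ln b" .
qed

theorem theorem1p6:
  "\<exists>C :: real list \<Rightarrow> real.
     computable_real_on {[a, b, c0] | a b c0. a > 0 \<and> b > 1 \<and> c0 > 0} C \<and>
     (\<forall>a b c0 :: real. a > 0 \<longrightarrow> b > 1 \<longrightarrow> c0 > 0 \<longrightarrow>
        C [a, b, c0] > 0 \<and>
        (\<forall>f :: complex \<Rightarrow> complex.
           f analytic_on ball 0 1 \<longrightarrow>
           (\<forall>z. 1 / 2 \<le> norm z \<and> norm z < 1 \<longrightarrow>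
              norm (f z) \<le> disk_phi z powr (c0 * disk_phi z)) \<longrightarrow>
           (\<forall>x::real. 0 < x \<and> x < 1 \<longrightarrow>
              norm (f (of_real x)) \<ge> a * b powr disk_phi (of_real x)) \<longrightarrow>
           (\<forall>H::real. H \<ge> exp 1 \<longrightarrow>
              (let S = {q::rat. 0 < q \<and> q < 1 \<and> of_int (mult_height q) \<le> H \<and>
                          (\<exists>r::rat. f (of_rat q) = of_rat r \<and> of_int (mult_height r) \<le> H)}
               in finite S \<and> real (card S) \<le> C [a, b, c0] * ln H ^ 18))))"
\<comment> \<open>The witness is the factor of \<open>L ^ 18\<close> in \<open>card_S_le\<close> at
  \<open>\<Lambda> = growth_scale xs\<close>.\<close>
proof (intro exI[of _ "\<lambda>xs. real (10 ^ 20) * growth_scale xs ^ 35"] conjI allI impI, goal_cases)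
  case 1
  show ?case by (rule computable_growth_scale_power)
next
  case (2 a b c0)
  then show ?case using growth_scale_bounds(1)[of a b c0] by simp
next
  case (3 a b c0 f H)
  define \<Lambda> where "\<Lambda> = growth_scale [a, b, c0]"
  define S where "S = {q. 0 < q \<and> q < 1 \<and> of_int (mult_height q) \<le> H \<and>
                 (\<exists>r. f (of_rat q) = of_rat r \<and> of_int (mult_height r) \<le> H)}"
  note \<Lambda> = growth_scale_bounds[OF 3(1,2,3), folded \<Lambda>_def]
  interpret rational_points f \<Lambda> H "ln H" S
  proof (unfold_locales, goal_cases)
    case 1
    show ?case using 3(4) by (rule analytic_imp_holomorphic)
  next
    case 2
    show ?case by (rule \<Lambda>)
  next
    case 3
    show ?case by fact
  next
    case (4 z)
    define \<phi> where "\<phi> = 1 / (1 - norm z)"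
    have \<phi>: "\<phi> > 0" using 4 by (simp add: \<phi>_def)
    \<comment> \<open>This crude bound replaces \<open>\<phi> powr (c0 * \<phi>)\<close> by an
      exponential of \<open>\<Lambda> * \<phi>\<^sup>2\<close>.\<close>
    have "ln \<phi> \<le> \<phi>" using ln_le_minus_one[OF \<phi>] by simp
    then have "c0 * (\<phi> * ln \<phi>) \<le> \<Lambda> * (\<phi> * \<phi>)"
      using \<Lambda> \<phi> 3(3) by (intro order_trans[OF mult_left_mono mult_right_mono]) auto
    moreover have "\<phi> powr (c0 * \<phi>) = exp (c0 * (\<phi> * ln \<phi>))" using \<phi> by (simp add: powr_def)
    moreover have "\<Lambda> / (1 - norm z)\<^sup>2 = \<Lambda> * (\<phi> * \<phi>)" by (simp add: \<phi>_def power2_eq_square)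
    ultimately have "\<phi> powr (c0 * \<phi>) \<le> exp (\<Lambda> / (1 - norm z)\<^sup>2)" by simp
    then show ?case using 3(5) 4 by (force simp: disk_phi_def \<phi>_def)
  next
    case (5 x)
    define \<phi> where "\<phi> = 1 / (1 - x)"
    have \<phi>: "\<phi> > 0" using 5 by (simp add: \<phi>_def)
    have "exp (1 / (2 * \<Lambda> * (1 - x))) / \<Lambda> = (1 / \<Lambda>) * exp (\<phi> * (1 / (2 * \<Lambda>)))"
      by (simp add: \<phi>_def)
    also have "\<dots> \<le> a * exp (\<phi> * ln b)"
      using \<Lambda> \<phi> 3(1) mult_left_mono[OF \<Lambda>(4), of \<phi>] by (intro mult_mono) auto
    also have "exp (\<phi> * ln b) = b powr \<phi>" using 3(2) by (simp add: powr_def)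
    also have "a * b powr \<phi> \<le> norm (f (of_real x))"
      using 3(6) 5 by (force simp: disk_phi_def \<phi>_def)
    finally show ?case .
  qed (simp_all add: S_def)
  show ?case
    using finite_S card_S_le unfolding Let_def by (simp add: S_def \<Lambda>_def)
qed

end
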